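(* Let $s,m\in\mathbb{N}$ and let $p\in\mathbb{Z}_2[x]$ be an irreducible polynomial of degree $m$. Let $q_1,\dots,q_{2^m}\in G_m$ and $\boldsymbol{\sigma}_1,\dots,\boldsymbol{\sigma}_{2^m}\in\mathbb{Q}_{2^m}^s$ be independent random variables, each uniformly distributed (the $q_r$ on $G_m$, the $\boldsymbol{\sigma}_r$ on $\mathbb{Q}_{2^m}^s$). Define the multiset (union with multiplicities) $$P:=\bigcup_{r=1}^{2^m}\bigl(P_p(q_r)\oplus\boldsymbol{\sigma}_r\bigr),$$ and write $N:=|P|=2^{2m}$. Then, for every $\delta\in(0,1)$, with probability at least $\delta$, the star discrepancy of $P\subseteq\mathbb{Q}_{2^m}^s$ satisfies $$D_N^\ast(P)\le C_0\,\frac{s(\log(2N)+1)+\log 2-\log(1-\delta)}{N^{1/2}},\qquad C_0:=\frac13\left(1+\sqrt{1+\frac{18}{\log 3}}\right)=1.723\ldots,$$ where $\log$ is the natural logarithm.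
   Context: Star discrepancy: for a finite multiset $P=\{\bm{x}_0,\dots,\bm{x}_{N-1}\}$ in $[0,1)^s$ (points counted with multiplicity), $D_N^*(P):=\sup_{\bm z\in[0,1]^s}\left|\frac1N\sum_{n=0}^{N-1}\mathbf 1_{[\bm 0,\bm z)}(\bm x_n)-\lambda([\bm 0,\bm z))\right|$, where $\mathbf 1_{[\bm 0,\bm z)}$ is the indicator function of $[\bm 0,\bm z)=\prod_{j=1}^s[0,z_j)$ and $\lambda$ is Lebesgue measure. $\mathbb{Z}_2=\{0,1\}$ is the field with two elements, with addition denoted $\oplus$; $G_m:=\{q\in\mathbb{Z}_2[x]:\deg(q)<m\}$ (including $0$); $\mathbb{Q}_{2^m}:=\{0,\frac1{2^m},\ldots,\frac{2^m-1}{2^m}\}$. An integer $n=\sum_{i=0}^{m-1}n_i2^i\in\{0,\dots,2^m-1\}$ with $n_i\in\{0,1\}$ is identified with the polynomial $n(x)=\sum_{i=0}^{m-1}n_ix^i\in G_m$. Every rational function over $\mathbb{Z}_2$ has a unique expansion in the field of formal Laurent series $\mathbb{Z}_2((x^{-1}))$. For $L(x)=\sum_{\ell=w}^{-\infty}a_\ell x^\ell\in\mathbb{Z}_2((x^{-1}))$ (a sum over descending $\ell\le w$, with $a_\ell:=0$ for $\ell>w$) set $\nu_m(L(x)):=\sum_{\ell=1}^m a_{-\ell}2^{-\ell}\in\mathbb{Q}_{2^m}$. Korobov polynomial lattice point set: for $q\in G_m$, $P_p(q)=\{\bm x_0(q),\dots,\bm x_{2^m-1}(q)\}\subseteq\mathbb{Q}_{2^m}^s$,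 where $\bm x_n(q)=\left(\nu_m\left(\frac{n(x)}{p(x)}\right),\nu_m\left(\frac{n(x)q(x)}{p(x)}\right),\ldots,\nu_m\left(\frac{n(x)q(x)^{s-1}}{p(x)}\right)\right)$ for $n=0,\dots,2^m-1$; the powers $1,q,\ldots,q^{s-1}$ are reduced modulo $p$, i.e. regarded as elements of $G_m$. Digital shift: for $x=\sum_{i=1}^m\xi_i2^{-i}$ and $\sigma=\sum_{i=1}^m\varsigma_i2^{-i}$ in $\mathbb{Q}_{2^m}$ with binary digits $\xi_i,\varsigma_i\in\mathbb{Z}_2$, $x\oplus\sigma:=\sum_{i=1}^m(\xi_i\oplus\varsigma_i)2^{-i}$; for vectors in $\mathbb{Q}_{2^m}^s$ it is defined componentwise, and for a point set $P=\{\bm x_0,\dots,\bm x_{N-1}\}\subseteq\mathbb{Q}_{2^m}^s$, $P\oplus\boldsymbol\sigma:=\{\bm x_0\oplus\boldsymbol\sigma,\dots,\bm x_{N-1}\oplus\boldsymbol\sigma\}$. *)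

theory Defs
  imports
    "HOL-Probability.Probability"
    "HOL-Library.Multiset"
    "HOL-Library.Z2"
    "HOL-Computational_Algebra.Computational_Algebra"
begin

text \<open>
  Points of s-dimensional space are functions \<^typ>\<open>nat \<Rightarrow> real\<close> that are extensional on
  \<open>{..<s}\<close>, so that the coordinates are numbered \<open>0, \<dots>, s - 1\<close> and products
  of sets and measures are \<^const>\<open>PiE\<close> and \<^const>\<open>PiM\<close>. The field with two elements is
  \<^typ>\<open>bit\<close>.
\<close>

definition anchored_box :: "nat \<Rightarrow> (nat \<Rightarrow> real) \<Rightarrow> (nat \<Rightarrow> real) set" where
  "anchored_box s z = (\<Pi>\<^sub>E j\<in>{..<s}. {0..<z j})"

definition star_discrepancy :: "nat \<Rightarrow> (nat \<Rightarrow> real) multiset \<Rightarrow> real" where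
  "star_discrepancy s P =
    (SUP z \<in> (\<Pi>\<^sub>E j\<in>{..<s}. {0..1}).
      \<bar>1 / real (size P) * (\<Sum>x\<in>#P. indicator (anchored_box s z) x)
        - measure (\<Pi>\<^sub>M j\<in>{..<s}. lborel) (anchored_box s z)\<bar>)"

definition polys_below :: "nat \<Rightarrow> bit poly set" where
  "polys_below m = {q. q = 0 \<or> degree q < m}"

definition dyadics :: "nat \<Rightarrow> real set" where
  "dyadics m = (\<lambda>k. real k / 2 ^ m) ` {..<2 ^ m}"

definition dyadic_points :: "nat \<Rightarrow> nat \<Rightarrow> (nat \<Rightarrow> real) set" where
  "dyadic_points m s = (\<Pi>\<^sub>E j\<in>{..<s}. dyadics m)"

text \<open>The map \<^const>\<open>of_nat\<close> into \<^typ>\<open>bit\<close> is reduction modulo 2; hence coefficient \<open>i\<close>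
  below is the binary digit \<open>i\<close> of \<open>n\<close>.\<close>

definition poly_of_num :: "nat \<Rightarrow> nat \<Rightarrow> bit poly" where
  "poly_of_num m n = (\<Sum>i<m. monom (of_nat (n div 2 ^ i)) i)"

text \<open>
  The library's Laurent series have finitely many terms of negative exponent in their variable
  \<^const>\<open>fls_X\<close>. Here this variable stands for \<open>1/x\<close>, so the coefficient of \<open>x\<close> to the power
  \<open>-l\<close> is \<open>fls_nth L l\<close>, and \<open>x\<close> itself is \<^const>\<open>fls_X_inv\<close>.
\<close>

definition laurent_of_poly :: "bit poly \<Rightarrow> bit fls" where
  "laurent_of_poly f = (\<Sum>i\<le>degree f. fls_const (coeff f i) * fls_X_inv ^ i)"

definition nu :: "nat \<Rightarrow> bit fls \<Rightarrow> real" where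
  "nu m L = (\<Sum>l=1..m. of_bit (fls_nth L (int l)) * (1 / 2 ^ l))"

definition korobov_point :: "nat \<Rightarrow> nat \<Rightarrow> bit poly \<Rightarrow> bit poly \<Rightarrow> nat \<Rightarrow> (nat \<Rightarrow> real)" where
  "korobov_point m s p q n =
    (\<lambda>j\<in>{..<s}. nu m (laurent_of_poly (poly_of_num m n * (q ^ j mod p)) / laurent_of_poly p))"

definition korobov_point_set :: "nat \<Rightarrow> nat \<Rightarrow> bit poly \<Rightarrow> bit poly \<Rightarrow> (nat \<Rightarrow> real) multiset" where
  "korobov_point_set m s p q = image_mset (korobov_point m s p q) (mset_set {..<2 ^ m})"

text \<open>The digit of \<open>x\<close> belonging to the weight \<open>1/2^i\<close>, for \<open>0 \<le> x < 1\<close>;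
  \<^const>\<open>of_int\<close> into \<^typ>\<open>bit\<close> is again reduction modulo 2.\<close>

definition binary_digit :: "nat \<Rightarrow> real \<Rightarrow> bit" where
  "binary_digit i x = of_int \<lfloor>2 ^ i * x\<rfloor>"

definition digit_add :: "nat \<Rightarrow> real \<Rightarrow> real \<Rightarrow> real" where
  "digit_add m x y = (\<Sum>i=1..m. of_bit (binary_digit i x + binary_digit i y) * (1 / 2 ^ i))"

definition digital_shift ::
  "nat \<Rightarrow> nat \<Rightarrow> (nat \<Rightarrow> real) \<Rightarrow> (nat \<Rightarrow> real) multiset \<Rightarrow> (nat \<Rightarrow> real) multiset" where
  "digital_shift m s \<sigma> P = image_mset (\<lambda>x. \<lambda>j\<in>{..<s}. digit_add m (x j) (\<sigma> j)) P"

text \<open>The sum of multisets adds multiplicities.\<close>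

definition shifted_union ::
  "nat \<Rightarrow> nat \<Rightarrow> bit poly \<Rightarrow> (nat \<Rightarrow> bit poly) \<Rightarrow> (nat \<Rightarrow> nat \<Rightarrow> real) \<Rightarrow> (nat \<Rightarrow> real) multiset" where
  "shifted_union m s p q \<sigma> =
    (\<Sum>r\<in>{1..2 ^ m}. digital_shift m s (\<sigma> r) (korobov_point_set m s p (q r)))"

definition uniformly_distributed :: "'w measure \<Rightarrow> ('w \<Rightarrow> 'a) \<Rightarrow> 'a set \<Rightarrow> bool" where
  "uniformly_distributed M X A \<longleftrightarrow>
    X \<in> M \<rightarrow>\<^sub>M count_space A \<and> distr M (count_space A) X = uniform_count_measure A"

text \<open>
  The predicate \<^const>\<open>prob_space.indep_vars\<close> is about one family of random variables with a common
  value type. To express that two families with different value types are independent all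
  together, they are combined into one family indexed by a disjoint sum, with tagged values.
\<close>

definition joint_family ::
  "('i \<Rightarrow> 'w \<Rightarrow> 'a) \<Rightarrow> ('j \<Rightarrow> 'w \<Rightarrow> 'b) \<Rightarrow> 'i + 'j \<Rightarrow> 'w \<Rightarrow> 'a + 'b" where
  "joint_family X Y k = (case k of Inl i \<Rightarrow> Inl \<circ> X i | Inr j \<Rightarrow> Inr \<circ> Y j)"

definition C0 :: real where
  "C0 = 1 / 3 * (1 + sqrt (1 + 18 / ln 3))"

end

theory Submission
  imports Defs
begin

text \<open>
  Write \<open>K\<close> for the polynomials of degree below \<open>m\<close>, that is, for the field with \<open>2 ^ m\<close> elements,
  and \<open>V\<close> for the points with dyadic coordinates. The map sending \<open>f\<close> to the first \<open>m\<close> binary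
  digits of \<open>f / p\<close> is a bijection from \<open>K\<close> to the dyadic numbers that turns addition into digitwise
  addition. Hence \<open>V\<close> is the vector space \<open>K ^ s\<close> in disguise, and a shifted Korobov point set is a
  line in it: the translates of the random point \<open>\<sigma>\<close> by all multiples of \<open>(1, q, ..., q ^ (s - 1))\<close>.
  
  Fix a box whose corner is a multiple of \<open>1 / 2 ^ m\<close>, and let \<open>g\<close> be its indicator minus its volume.
  This \<open>g\<close> is bounded by 1 and sums to 0 over \<open>V\<close>. Let \<open>Y\<close> be the sum of \<open>g\<close> over one random
  line; then \<open>\<bar>Y\<bar> \<le> 2 ^ m\<close> and the mean of \<open>Y\<close> is 0. The essential point is that the second moment of
  \<open>Y\<close> is at most \<open>(s - 1) * 2 ^ m\<close>, as if the points of a line were nearly uncorrelated. Averaging over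
  all lines of one direction is an orthogonal projection on the functions on \<open>V\<close>. These projections
  commute, and \<open>s\<close> directions belonging to different \<open>q\<close> span \<open>V\<close> by a Vandermonde argument, so that the
  product of \<open>s\<close> of them annihilates \<open>g\<close>. When commuting projections have this property, the squared
  norms of the projections of \<open>g\<close> add up to at most \<open>(s - 1)\<close> times the squared norm of \<open>g\<close>
  (\<open>sum_form_average_le\<close>, \<open>sum_line_sum_square_le\<close>).
  
  As \<open>exp u \<le> 1 + u + u\<^sup>2\<close> for \<open>\<bar>u\<bar> \<le> 1\<close>, the mean of \<open>exp (Y / 2 ^ m)\<close> is at most
  \<open>exp ((s - 1) / 2 ^ m)\<close>. The \<open>2 ^ m\<close> lines are independent, so the Chernoff bound shows that the sum of
  \<open>g\<close> over the whole multiset exceeds \<open>2 ^ m * U\<close> with probability at most \<open>exp (s - 1 - U)\<close>. There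
  are \<open>(2 ^ m + 1) ^ s\<close> such boxes and two signs, and an arbitrary box differs from one of them by at most
  \<open>s / 2 ^ m\<close> in volume and not at all in its dyadic points. The choice
  \<open>U = C0 * (s * ln (2 * N) + ln 2 - ln (1 - \<delta>))\<close> makes the union bound at most \<open>1 - \<delta>\<close>.
  
  Since all random variables take finitely many values and are uniform and independent, their joint law
  is uniform on a finite set (\<open>prob_joint_uniform\<close>), and every probability above is a proportion of
  that set.
\<close>

section \<open>Averages over commuting translations\<close>

text \<open>
  The index \<open>i\<close> is a direction and \<open>t i a\<close> the translation by the multiple \<open>a\<close> of that direction. Every
  translation is its own inverse, as in a vector space of characteristic two.
\<close>
locale commuting_translations =
  fixes V :: "'v set" and K :: "'k::ab_group_add set" and I :: "'i set"
    and t :: "'i \<Rightarrow> 'k \<Rightarrow> 'v \<Rightarrow> 'v"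
  assumes finite_V: "finite V" and finite_K: "finite K" and K_nonempty: "K \<noteq> {}"
    and K_add: "\<And>a b. a \<in> K \<Longrightarrow> b \<in> K \<Longrightarrow> a + b \<in> K"
    and t_closed: "\<And>i a x. i \<in> I \<Longrightarrow> a \<in> K \<Longrightarrow> x \<in> V \<Longrightarrow> t i a x \<in> V"
    and t_involution: "\<And>i a x. i \<in> I \<Longrightarrow> a \<in> K \<Longrightarrow> x \<in> V \<Longrightarrow> t i a (t i a x) = x"
    and t_add: "\<And>i a b x. i \<in> I \<Longrightarrow> a \<in> K \<Longrightarrow> b \<in> K \<Longrightarrow> x \<in> V \<Longrightarrow> t i a (t i b x) = t i (a + b) x"
    and t_commute: "\<And>i j a b x. i \<in> I \<Longrightarrow> j \<in> I \<Longrightarrow> a \<in> K \<Longrightarrow> b \<in> K \<Longrightarrow> x \<in> V \<Longrightarrow>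
      t i a (t j b x) = t j b (t i a x)"
begin

definition average :: "'i \<Rightarrow> ('v \<Rightarrow> real) \<Rightarrow> 'v \<Rightarrow> real" where
  "average i f x = (\<Sum>a\<in>K. f (t i a x)) / card K"

definition invariant :: "'i \<Rightarrow> ('v \<Rightarrow> real) \<Rightarrow> bool" where
  "invariant i f \<longleftrightarrow> (\<forall>a\<in>K. \<forall>x\<in>V. f (t i a x) = f x)"

definition form :: "('v \<Rightarrow> real) \<Rightarrow> ('v \<Rightarrow> real) \<Rightarrow> real" where
  "form f g = (\<Sum>x\<in>V. f x * g x)"

lemma card_K_pos: "card K > 0"
  using finite_K K_nonempty by (simp add: card_gt_0_iff)

lemma form_diff_right: "form f (\<lambda>x. g x - h x) = form f g - form f h"
  by (simp add: form_def right_diff_distrib sum_subtractf)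

lemma form_cong: "(\<And>x. x \<in> V \<Longrightarrow> f x = f' x) \<Longrightarrow> (\<And>x. x \<in> V \<Longrightarrow> g x = g' x) \<Longrightarrow> form f g = form f' g'"
  unfolding form_def by (intro sum.cong) auto

lemma invariant_average_self:
  assumes "i \<in> I" shows "invariant i (average i f)"
  unfolding invariant_def
proof (intro ballI)
  fix b x assume b: "b \<in> K" and x: "x \<in> V"
  have inj: "inj_on (\<lambda>a. a + b) K" by (simp add: inj_on_def)
  have "(\<lambda>a. a + b) ` K = K"
    by (intro endo_inj_surj finite_K inj) (use K_add b in auto)
  then have bij: "bij_betw (\<lambda>a. a + b) K K"
    using inj by (simp add: bij_betw_def)
  have "(\<Sum>a\<in>K. f (t i a (t i b x))) = (\<Sum>a\<in>K. f (t i (a + b) x))"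
    by (intro sum.cong) (use t_add assms b x in auto)
  also have "\<dots> = (\<Sum>a\<in>K. f (t i a x))"
    by (rule sum.reindex_bij_betw[OF bij])
  finally show "average i f (t i b x) = average i f x"
    by (simp add: average_def)
qed

lemma invariant_average:
  assumes "i \<in> I" "j \<in> I" "invariant j f" shows "invariant j (average i f)"
  unfolding invariant_def
proof (intro ballI)
  fix b x assume b: "b \<in> K" and x: "x \<in> V"
  have "f (t i a (t j b x)) = f (t i a x)" if a: "a \<in> K" for a
  proof -
    have "f (t i a (t j b x)) = f (t j b (t i a x))"
      by (simp only: t_commute[OF assms(1,2) a b x])
    also have "\<dots> = f (t i a x)"
      using assms(3) b t_closed[OF assms(1) a x] by (simp add: invariant_def)
    finally show ?thesis .
  qed
  then show "average i f (t j b x) = average i f x"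
    by (simp add: average_def)
qed

lemma average_invariant:
  assumes "invariant i f" "x \<in> V" shows "average i f x = f x"
proof -
  have "(\<Sum>a\<in>K. f (t i a x)) = (\<Sum>a\<in>K. f x)"
    by (intro sum.cong refl) (use assms in \<open>auto simp: invariant_def\<close>)
  then show ?thesis
    using card_K_pos by (simp add: average_def)
qed

text \<open>
  Averages are self-adjoint because each translation permutes \<open>V\<close> and is its own inverse.
\<close>
lemma form_average:
  assumes "i \<in> I" shows "form (average i f) g = form f (average i g)"
proof -
  have swap: "(\<Sum>x\<in>V. f (t i a x) * g x) = (\<Sum>x\<in>V. f x * g (t i a x))" if "a \<in> K" for a
    by (rule sum.reindex_bij_witness[where i = "t i a" and j = "t i a"])
       (use assms that t_involution t_closed in auto)
  have "form (average i f) g = (\<Sum>x\<in>V. \<Sum>a\<in>K. f (t i a x) * g x) / card K"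
    by (simp add: form_def average_def sum_divide_distrib sum_distrib_right)
  also have "\<dots> = (\<Sum>a\<in>K. \<Sum>x\<in>V. f (t i a x) * g x) / card K"
    by (subst sum.swap) simp
  also have "\<dots> = (\<Sum>a\<in>K. \<Sum>x\<in>V. f x * g (t i a x)) / card K"
    by (simp add: swap)
  also have "\<dots> = (\<Sum>x\<in>V. \<Sum>a\<in>K. f x * g (t i a x)) / card K"
    by (subst sum.swap) simp
  also have "\<dots> = form f (average i g)"
    by (simp add: form_def average_def sum_divide_distrib sum_distrib_left)
  finally show ?thesis .
qed

lemma average_diff: "average i (\<lambda>x. f x - g x) x = average i f x - average i g x"
  by (simp add: average_def sum_subtractf diff_divide_distrib)

text \<open>
  The average in direction \<open>i\<close> is the orthogonal projection onto the functions invariant in that direction.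
\<close>
lemma form_invariant_remainder:
  assumes "i \<in> I" "invariant i f"
  shows "form f (\<lambda>x. g x - average i g x) = 0"
proof -
  have "form f (average i g) = form (average i f) g"
    by (rule form_average[OF assms(1), symmetric])
  also have "\<dots> = form f g"
    by (intro form_cong average_invariant assms(2) refl)
  finally have "form f (average i g) = form f g" .
  then show ?thesis by (simp add: form_diff_right)
qed

text \<open>
  The hypothesis says, without speaking of products of operators, that the product of any \<open>k + 1\<close> of the
  projections annihilates \<open>g\<close>. In a joint eigenbasis the claim is clear: each eigenvector that occurs in
  \<open>g\<close> is fixed by at most \<open>k\<close> of the projections. The induction avoids the eigenbasis by splitting
  \<open>g\<close> with a single projection \<open>j\<close>. Its image \<open>a\<close> satisfies the hypothesis for the remaining
  directions with \<open>k - 1\<close> in place of \<open>k\<close>, because the direction \<open>j\<close> can be added to any \<open>k\<close> of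
  them; its remainder \<open>b\<close> satisfies it with the same \<open>k\<close>.
\<close>
lemma sum_form_average_le:
  assumes "finite Q" "Q \<subseteq> I"
    and "\<And>A f. A \<subseteq> Q \<Longrightarrow> card A = Suc k \<Longrightarrow> (\<And>i. i \<in> A \<Longrightarrow> invariant i f) \<Longrightarrow> form f g = 0"
  shows "(\<Sum>i\<in>Q. form (average i g) (average i g)) \<le> real k * form g g"
  using assms
proof (induction Q arbitrary: k g rule: finite_induct)
  case empty
  then show ?case by (simp add: form_def sum_nonneg)
next
  case (insert j Q)
  have j: "j \<in> I" and QI: "Q \<subseteq> I" using insert.prems(1) by auto
  show ?case
  proof (cases k)
    case 0
    have "form (average i g) (average i g) = 0" if "i \<in> insert j Q" for i
    proof -
      have i: "i \<in> I" using that insert.prems(1) by auto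
      have "form (average i g) (average i g) = form (average i (average i g)) g"
        using form_average[OF i] by simp
      also have "\<dots> = form (average i g) g"
        by (intro form_cong refl average_invariant invariant_average_self i)
      also have "\<dots> = 0"
        by (rule insert.prems(2)[of "{i}"]) (use that 0 i in \<open>auto intro: invariant_average_self\<close>)
      finally show ?thesis .
    qed
    then show ?thesis using 0 by simp
  next
    case (Suc l)
    define a where "a = average j g"
    define b where "b = (\<lambda>x. g x - a x)"
    have inv_a: "invariant j a" unfolding a_def by (rule invariant_average_self[OF j])
    have orth: "form f b = 0" if "invariant j f" for f
      unfolding b_def a_def by (rule form_invariant_remainder[OF j that])
    have pythagoras: "form (\<lambda>x. u x + v x) (\<lambda>x. u x + v x) = form u u + form v v"
      if "form u v = 0" for u v
    proof -
      have "(u x + v x) * (u x + v x) = u x * u x + v x * v x + 2 * (u x * v x)" for x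
        by (simp add: algebra_simps)
      then show ?thesis
        using that unfolding form_def by (simp add: sum.distrib flip: sum_distrib_left)
    qed
    have "g = (\<lambda>x. a x + b x)" by (simp add: b_def)
    then have norm_g: "form g g = form a a + form b b"
      using pythagoras[OF orth[OF inv_a]] by simp
    \<comment> \<open>Invariance in direction j is inherited by averages in other directions, so the two parts
      stay orthogonal after any of the projections.\<close>
    have split: "form (average i g) (average i g)
        = form (average i a) (average i a) + form (average i b) (average i b)" if "i \<in> Q" for i
    proof -
      have i: "i \<in> I" using that QI by auto
      have eq: "average i g = (\<lambda>x. average i a x + average i b x)"
        by (rule ext) (simp add: b_def average_diff)
      have "form (average i a) (average i b) = form (average i (average i a)) b"
        using form_average[OF i] by simp
      also have "\<dots> = form (average i a) b"
        by (intro form_cong refl average_invariant invariant_average_self i)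
      also have "\<dots> = 0"
        by (intro orth invariant_average i j inv_a)
      finally show ?thesis using pythagoras eq by simp
    qed
    have a_zero: "form f a = 0"
      if "A \<subseteq> Q" "card A = Suc l" "\<And>i. i \<in> A \<Longrightarrow> invariant i f" for A f
    proof -
      have "form f a = form (average j f) g"
        unfolding a_def by (simp add: form_average[OF j])
      also have "\<dots> = 0"
      proof (rule insert.prems(2)[of "insert j A"])
        show "insert j A \<subseteq> insert j Q" using that by auto
        show "card (insert j A) = Suc k"
          using that insert.hyps Suc by (metis card_insert_disjoint finite_subset subsetD)
        show "invariant i (average j f)" if "i \<in> insert j A" for i
          using that \<open>\<And>i. i \<in> A \<Longrightarrow> invariant i f\<close> \<open>A \<subseteq> Q\<close> QI j
          by (cases "i = j") (auto intro: invariant_average_self invariant_average)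
      qed
      finally show ?thesis .
    qed
    have b_zero: "form f b = 0"
      if A: "A \<subseteq> Q" "card A = Suc k" "\<And>i. i \<in> A \<Longrightarrow> invariant i f" for A f
    proof -
      have "form f g = 0" by (rule insert.prems(2)[of A]) (use A in auto)
      moreover have "form f a = form (average j f) g"
        unfolding a_def by (simp add: form_average[OF j])
      moreover have "form (average j f) g = 0"
        by (rule insert.prems(2)[of A]) (use A QI j in \<open>auto intro!: invariant_average\<close>)
      ultimately show ?thesis by (simp add: b_def form_diff_right)
    qed
    have bound_a: "(\<Sum>i\<in>Q. form (average i a) (average i a)) \<le> real l * form a a"
      by (rule insert.IH[OF QI]) (rule a_zero)
    have bound_b: "(\<Sum>i\<in>Q. form (average i b) (average i b)) \<le> real k * form b b"
      by (rule insert.IH[OF QI]) (rule b_zero)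
    have "(\<Sum>i\<in>insert j Q. form (average i g) (average i g))
        = form a a + ((\<Sum>i\<in>Q. form (average i a) (average i a)) + (\<Sum>i\<in>Q. form (average i b) (average i b)))"
      using insert.hyps by (simp add: split a_def[symmetric] sum.distrib)
    also have "\<dots> \<le> form a a + (real l * form a a + real k * form b b)"
      by (intro add_mono order_refl bound_a bound_b)
    also have "\<dots> = real k * form g g"
      by (simp add: norm_g Suc algebra_simps)
    finally show ?thesis .
  qed
qed

end

section \<open>Digitwise addition of dyadic numbers\<close>

lemma bit_add_self [simp]: "(a::bit) + a = 0"
  by (cases a) simp_all

lemma bit_poly_add_self [simp]: "(f::bit poly) + f = 0"
  by (rule poly_eqI) (simp only: coeff_add bit_add_self coeff_0)

lemma bit_poly_minus: "(f::bit poly) - g = f + g"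
  by (metis add_diff_cancel_right' add.right_neutral add.assoc bit_poly_add_self)

definition dyadic_value :: "nat \<Rightarrow> (nat \<Rightarrow> bit) \<Rightarrow> real" where
  "dyadic_value m a = (\<Sum>i=1..m. of_bit (a i) * (1 / 2 ^ i))"

lemma dyadic_value_cong:
  "(\<And>i. i \<in> {1..m} \<Longrightarrow> a i = b i) \<Longrightarrow> dyadic_value m a = dyadic_value m b"
  unfolding dyadic_value_def by (intro sum.cong) auto

lemma bit_of_nat_double: "(of_nat (2 * k) :: bit) = 0"
  by simp

text \<open>
  Appending the digit \<open>b\<close> turns the numerator \<open>k\<close> into \<open>2 * k + b\<close>; this gives all digits of the
  numerator at once.
\<close>
lemma dyadic_value_numerator:
  "\<exists>k<2 ^ m. dyadic_value m a = real k / 2 ^ m \<and> (\<forall>i\<in>{1..m}. of_nat (k div 2 ^ (m - i)) = a i)"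
proof (induction m)
  case 0
  then show ?case by (simp add: dyadic_value_def)
next
  case (Suc m)
  then obtain k where k: "k < 2 ^ m" "dyadic_value m a = real k / 2 ^ m"
    and digits: "\<And>i. i \<in> {1..m} \<Longrightarrow> of_nat (k div 2 ^ (m - i)) = a i" by blast
  define b :: nat where "b = of_bit (a (Suc m))"
  have b: "b \<le> 1" by (simp add: b_def)
  have "dyadic_value (Suc m) a = dyadic_value m a + real b / 2 ^ Suc m"
    by (simp add: dyadic_value_def b_def)
  also have "\<dots> = real (2 * k + b) / 2 ^ Suc m"
    using k(2) by (simp add: add_divide_distrib)
  finally have "dyadic_value (Suc m) a = real (2 * k + b) / 2 ^ Suc m" .
  moreover have "2 * k + b < 2 ^ Suc m"
    using k(1) b by simp
  moreover have "of_nat ((2 * k + b) div 2 ^ (Suc m - i)) = a i" if i: "i \<in> {1..Suc m}" for i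
  proof (cases "i = Suc m")
    case True
    have "(of_nat (2 * k + b) :: bit) = of_nat b"
      by (simp only: of_nat_add bit_of_nat_double add_0_left)
    also have "\<dots> = a (Suc m)"
      unfolding b_def by (cases "a (Suc m)") simp_all
    finally show ?thesis using True by simp
  next
    case False
    then have i: "i \<in> {1..m}" using i by auto
    then have "Suc m - i = Suc (m - i)" by auto
    then have "(2 * k + b) div 2 ^ (Suc m - i) = ((2 * k + b) div 2) div 2 ^ (m - i)"
      by (simp add: div_mult2_eq)
    also have "(2 * k + b) div 2 = k" using b by simp
    finally show ?thesis using digits[OF i] by simp
  qed
  ultimately show ?case by blast
qed

lemma binary_digit_dyadic:
  assumes "i \<le> m" shows "binary_digit i (real k / 2 ^ m) = of_nat (k div 2 ^ (m - i))"
proof -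
  have "2 ^ i * (real k / 2 ^ m) = real k / real (2 ^ (m - i))"
  proof -
    have "(2::real) ^ m = 2 ^ i * 2 ^ (m - i)"
      using assms by (simp flip: power_add)
    then show ?thesis by simp
  qed
  then have "\<lfloor>2 ^ i * (real k / 2 ^ m)\<rfloor> = int (k div 2 ^ (m - i))"
    by (simp only: floor_divide_of_nat_eq)
  then show ?thesis by (simp only: binary_digit_def of_int_of_nat_eq)
qed

lemma binary_digit_dyadic_value:
  assumes "i \<in> {1..m}" shows "binary_digit i (dyadic_value m a) = a i"
  using dyadic_value_numerator[of m a] binary_digit_dyadic[of i m] assms by auto

lemma dyadic_value_in_dyadics: "dyadic_value m a \<in> dyadics m"
  using dyadic_value_numerator[of m a] by (auto simp: dyadics_def)

lemma finite_dyadics: "finite (dyadics m)"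
  by (simp add: dyadics_def)

lemma card_dyadics: "card (dyadics m) = 2 ^ m"
  unfolding dyadics_def by (subst card_image) (auto simp: inj_on_def)

text \<open>
  The digit sequences of length \<open>m\<close> are mapped injectively to the dyadic numbers, as they can be read off,
  and there are equally many of both; so every dyadic number is reached.
\<close>
lemma dyadic_value_binary_digit:
  assumes "x \<in> dyadics m" shows "dyadic_value m (\<lambda>i. binary_digit i x) = x"
proof -
  define D :: "(nat \<Rightarrow> bit) set" where "D = ({1..m} \<rightarrow>\<^sub>E UNIV)"
  have inj: "inj_on (dyadic_value m) D"
  proof (rule inj_onI)
    fix a b assume ab: "a \<in> D" "b \<in> D" "dyadic_value m a = dyadic_value m b"
    show "a = b"
    proof (rule PiE_ext[of a "{1..m}" "\<lambda>_. UNIV" b])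
      show "a \<in> {1..m} \<rightarrow>\<^sub>E UNIV" "b \<in> {1..m} \<rightarrow>\<^sub>E UNIV" using ab by (simp_all add: D_def)
      show "a i = b i" if "i \<in> {1..m}" for i
        using binary_digit_dyadic_value[OF that, of a] binary_digit_dyadic_value[OF that, of b] ab(3)
        by simp
    qed
  qed
  have univ: "(UNIV :: bit set) = {0, 1}"
    using bit_not_zero_iff by blast
  have "card D = 2 ^ m"
    unfolding D_def univ by (simp add: card_PiE numeral_2_eq_2)
  then have "dyadic_value m ` D = dyadics m"
    using inj by (intro card_subset_eq finite_dyadics)
      (auto simp: dyadic_value_in_dyadics card_image card_dyadics)
  then obtain a where a: "x = dyadic_value m a" using assms by auto
  show ?thesis
    unfolding a by (intro dyadic_value_cong) (rule binary_digit_dyadic_value)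
qed

lemma digit_add_eq_dyadic_value:
  "digit_add m x y = dyadic_value m (\<lambda>i. binary_digit i x + binary_digit i y)"
  by (simp only: digit_add_def dyadic_value_def)

lemma digit_add_in_dyadics: "digit_add m x y \<in> dyadics m"
  by (simp only: digit_add_eq_dyadic_value dyadic_value_in_dyadics)

lemma binary_digit_digit_add:
  "i \<in> {1..m} \<Longrightarrow> binary_digit i (digit_add m x y) = binary_digit i x + binary_digit i y"
  by (simp only: digit_add_eq_dyadic_value binary_digit_dyadic_value)

lemma digit_add_commute: "digit_add m x y = digit_add m y x"
  unfolding digit_add_def by (simp only: add.commute)

lemma digit_add_assoc: "digit_add m (digit_add m x y) z = digit_add m x (digit_add m y z)"
proof -
  have "digit_add m (digit_add m x y) z
      = dyadic_value m (\<lambda>i. binary_digit i x + (binary_digit i y + binary_digit i z))"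
    unfolding digit_add_eq_dyadic_value[of m "digit_add m x y"]
    by (intro dyadic_value_cong) (simp only: binary_digit_digit_add add.assoc)
  also have "\<dots> = digit_add m x (digit_add m y z)"
    unfolding digit_add_eq_dyadic_value[of m x "digit_add m y z"]
    by (intro dyadic_value_cong) (simp only: binary_digit_digit_add)
  finally show ?thesis .
qed

lemma digit_add_cancel:
  assumes "x \<in> dyadics m" shows "digit_add m (digit_add m x y) y = x"
proof -
  have "digit_add m (digit_add m x y) y = dyadic_value m (\<lambda>i. binary_digit i x)"
    unfolding digit_add_eq_dyadic_value[of m "digit_add m x y"]
    by (intro dyadic_value_cong) (simp only: binary_digit_digit_add add.assoc bit_add_self add_0_right)
  then show ?thesis using dyadic_value_binary_digit[OF assms] by simp
qed

lemma digit_add_dyadic_value: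
  "digit_add m (dyadic_value m a) (dyadic_value m b) = dyadic_value m (\<lambda>i. a i + b i)"
  unfolding digit_add_eq_dyadic_value
  by (intro dyadic_value_cong) (simp only: binary_digit_dyadic_value)

section \<open>Binary digits of rational functions\<close>

lemma laurent_of_poly_nth:
  "fls_nth (laurent_of_poly f) i = (if i \<le> 0 then coeff f (nat (- i)) else 0)"
proof -
  have "fls_nth (laurent_of_poly f) i
      = (\<Sum>k\<le>degree f. if i = - int k then coeff f k else 0)"
    unfolding laurent_of_poly_def fls_nth_sum
    by (intro sum.cong refl) (simp only: fls_mult_const_nth fls_X_inv_power_nth mult_1_right mult_zero_right split: if_splits, simp)
  also have "\<dots> = (if i \<le> 0 then coeff f (nat (- i)) else 0)"
  proof (cases "i \<le> 0")
    case True
    then have "(i = - int k) = (k = nat (- i))" for k by auto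
    then show ?thesis using True by (simp add: sum.delta coeff_eq_0)
  qed (auto intro: sum.neutral)
  finally show ?thesis .
qed

lemma laurent_of_poly_0 [simp]: "laurent_of_poly 0 = 0"
  by (simp add: laurent_of_poly_def)

lemma laurent_of_poly_add: "laurent_of_poly (f + g) = laurent_of_poly f + laurent_of_poly g"
  by (rule fls_eqI) (simp only: laurent_of_poly_nth fls_plus_nth coeff_add split: if_splits, simp)

lemma laurent_of_poly_pCons:
  "laurent_of_poly (pCons a f) = fls_const a + fls_X_inv * laurent_of_poly f"
proof (rule fls_eqI)
  fix i :: int
  have "nat (- i) = Suc (nat (- 1 - i))" if "i < 0" using that by auto
  moreover have "nat (- 1 - i) = nat (- (i + 1))" by simp
  ultimately show "fls_nth (laurent_of_poly (pCons a f)) i = fls_nth (fls_const a + fls_X_inv * laurent_of_poly f) i"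
    by (auto simp: laurent_of_poly_nth fls_X_inv_times_conv_shift coeff_pCons simp del: add_bit_eq_xor split: nat.splits)
qed

lemma laurent_of_poly_smult: "laurent_of_poly (smult a f) = fls_const a * laurent_of_poly f"
  by (rule fls_eqI) (simp only: laurent_of_poly_nth fls_mult_const_nth coeff_smult mult_zero_right split: if_splits, simp)

text \<open>
  Recursion on the first factor reduces multiplicativity to the expansions of \<open>pCons\<close> and \<open>smult\<close>.
\<close>
lemma laurent_of_poly_mult: "laurent_of_poly (f * g) = laurent_of_poly f * laurent_of_poly g"
proof (induction f)
  case (pCons a f)
  have "laurent_of_poly (pCons a f * g) = fls_const a * laurent_of_poly g + fls_X_inv * laurent_of_poly (f * g)"
    by (simp only: mult_pCons_left laurent_of_poly_add laurent_of_poly_smult laurent_of_poly_pCons fls_const_0 add_0_left)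
  also have "\<dots> = laurent_of_poly (pCons a f) * laurent_of_poly g"
    by (simp only: pCons.IH laurent_of_poly_pCons distrib_right mult.assoc)
  finally show ?case .
qed simp

lemma laurent_of_poly_eq_0_iff: "laurent_of_poly f = 0 \<longleftrightarrow> f = 0"
proof
  assume "laurent_of_poly f = 0"
  then have "coeff f n = 0" for n
    using laurent_of_poly_nth[of f "- int n"] by simp
  then show "f = 0" by (simp add: poly_eq_iff)
qed simp

definition frac_value :: "nat \<Rightarrow> bit poly \<Rightarrow> bit poly \<Rightarrow> real" where
  "frac_value m p f = nu m (laurent_of_poly f / laurent_of_poly p)"

lemma frac_value_eq_dyadic_value:
  "frac_value m p f = dyadic_value m (\<lambda>i. fls_nth (laurent_of_poly f / laurent_of_poly p) (int i))"
  by (simp only: frac_value_def nu_def dyadic_value_def)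

lemma frac_value_in_dyadics: "frac_value m p f \<in> dyadics m"
  by (simp only: frac_value_eq_dyadic_value dyadic_value_in_dyadics)

lemma frac_value_add: "frac_value m p (f + g) = digit_add m (frac_value m p f) (frac_value m p g)"
  by (simp only: frac_value_eq_dyadic_value digit_add_dyadic_value laurent_of_poly_add
      add_divide_distrib fls_plus_nth)

text \<open>
  Multiples of \<open>p\<close> contribute a polynomial to the quotient, which has no digits after the point.
\<close>
lemma frac_value_add_multiple:
  assumes "p \<noteq> 0" shows "frac_value m p (f + p * h) = frac_value m p f"
proof -
  have "laurent_of_poly (f + p * h) / laurent_of_poly p
      = laurent_of_poly f / laurent_of_poly p + laurent_of_poly h"
    using assms laurent_of_poly_eq_0_iff[of p]
    by (simp only: laurent_of_poly_add laurent_of_poly_mult add_divide_distrib nonzero_mult_div_cancel_left not_False_eq_True)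
  then show ?thesis
    unfolding frac_value_eq_dyadic_value
    by (intro dyadic_value_cong) (simp add: laurent_of_poly_nth)
qed

lemma frac_value_mod: "p \<noteq> 0 \<Longrightarrow> frac_value m p (f mod p) = frac_value m p f"
  using frac_value_add_multiple[of p m "f mod p" "f div p"] by simp

lemma frac_value_mult_mod:
  assumes "p \<noteq> 0" shows "frac_value m p (f * (g mod p)) = frac_value m p (f * g)"
  using frac_value_mod[OF assms, of m "f * (g mod p)"] frac_value_mod[OF assms, of m "f * g"]
  by (simp only: mod_mult_right_eq)

text \<open>
  Let \<open>g\<close> be the remainder of \<open>f\<close> modulo \<open>p\<close>. The quotient \<open>g / p\<close>, a series in
  \<open>1 / x\<close>, has no polynomial part. If its first \<open>m\<close> digits vanish too, then its lowest exponent is above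
  \<open>m\<close>, and multiplication by \<open>p\<close>, which lowers this exponent by \<open>m\<close>, leaves only positive exponents.
  A nonzero polynomial in \<open>x\<close> has none of these.
\<close>
lemma frac_value_zero_imp_dvd:
  assumes "p \<noteq> 0" "degree p = m" "frac_value m p f = 0"
  shows "p dvd f"
proof -
  define g where "g = f mod p"
  define L where "L = laurent_of_poly g / laurent_of_poly p"
  have p0: "laurent_of_poly p \<noteq> 0" using assms(1) by (simp add: laurent_of_poly_eq_0_iff)
  have L_mult: "laurent_of_poly p * L = laurent_of_poly g"
    using p0 by (simp add: L_def)
  have sub_p: "fls_subdegree (laurent_of_poly p) = - int m"
  proof (rule fls_subdegree_eqI)
    show "fls_nth (laurent_of_poly p) (- int m) \<noteq> 0"
      using assms(1) by (simp add: laurent_of_poly_nth del: bit_not_zero_iff flip: assms(2))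
    show "fls_nth (laurent_of_poly p) k = 0" if "k < - int m" for k
      using that assms(2) by (simp add: laurent_of_poly_nth coeff_eq_0)
  qed
  have "g = 0"
  proof (rule ccontr)
    assume g: "g \<noteq> 0"
    have Lne: "L \<noteq> 0" using L_mult g laurent_of_poly_eq_0_iff[of g] by auto
    have sub_g: "- int (degree g) \<le> fls_subdegree (laurent_of_poly g)"
      using g laurent_of_poly_eq_0_iff[of g]
      by (intro fls_subdegree_geI) (auto simp: laurent_of_poly_nth coeff_eq_0)
    have sub_g': "fls_subdegree (laurent_of_poly g) \<le> 0"
    proof (rule fls_subdegree_leI'[of _ "- int (degree g)"])
      show "fls_nth (laurent_of_poly g) (- int (degree g)) \<noteq> 0"
        using g by (simp add: laurent_of_poly_nth del: bit_not_zero_iff)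
    qed simp
    have sub: "fls_subdegree (laurent_of_poly g) = - int m + fls_subdegree L"
      using L_mult p0 Lne sub_p by (metis fls_subdegree_mult)
    have "degree g < m" using g assms(1,2) degree_mod_less[of p f] by (simp add: g_def)
    then have low: "1 \<le> fls_subdegree L" using sub sub_g by linarith
    have "dyadic_value m (\<lambda>i. fls_nth L (int i)) = 0"
      using assms(3) frac_value_mod[OF assms(1), of m f]
      by (simp only: frac_value_eq_dyadic_value[of m p "f mod p"] L_def g_def)
    then have digits: "fls_nth L (int i) = 0" if "i \<in> {1..m}" for i
      using binary_digit_dyadic_value[OF that, of "\<lambda>i. fls_nth L (int i)"] by (simp add: binary_digit_def)
    have "int m < fls_subdegree L"
    proof (rule ccontr)
      assume "\<not> int m < fls_subdegree L"
      then have "nat (fls_subdegree L) \<in> {1..m}" using low by auto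
      from digits[OF this] have "fls_nth L (fls_subdegree L) = 0" using low by simp
      then show False using Lne nth_fls_subdegree_nonzero by blast
    qed
    then show False using sub sub_g' by linarith
  qed
  then show ?thesis by (simp add: g_def dvd_eq_mod_eq_0)
qed

section \<open>Polynomials of bounded degree and dyadic points\<close>

lemma coeff_poly_of_num: "coeff (poly_of_num m n) i = (if i < m then of_nat (n div 2 ^ i) else 0)"
proof -
  have "coeff (poly_of_num m n) i = (\<Sum>k<m. if k = i then of_nat (n div 2 ^ k) else 0)"
    unfolding poly_of_num_def coeff_sum coeff_monom ..
  then show ?thesis by (simp add: sum.delta)
qed

lemma polys_below_iff: "f \<in> polys_below m \<longleftrightarrow> (\<forall>i\<ge>m. coeff f i = 0)"
proof
  assume "\<forall>i\<ge>m. coeff f i = 0"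
  then have "f = 0 \<or> degree f < m"
    using leading_coeff_0_iff[of f] not_less by blast
  then show "f \<in> polys_below m" by (simp add: polys_below_def)
qed (auto simp: polys_below_def coeff_eq_0)

lemma polys_below_add: "f \<in> polys_below m \<Longrightarrow> g \<in> polys_below m \<Longrightarrow> f + g \<in> polys_below m"
  unfolding polys_below_iff coeff_add by simp

lemma zero_in_polys_below: "0 \<in> polys_below m"
  by (simp add: polys_below_def)

lemma bij_betw_poly_of_num: "bij_betw (poly_of_num m) {..<2 ^ m} (polys_below m)"
  unfolding bij_betw_def
proof (intro conjI equalityI subsetI)
  have parity: "(of_nat a :: bit) = of_nat b \<longleftrightarrow> (even a \<longleftrightarrow> even b)" for a b
    by (cases "even a"; cases "even b") (auto elim!: evenE oddE)
  show "inj_on (poly_of_num m) {..<2 ^ m}"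
  proof (rule inj_onI)
    fix a b :: nat assume ab: "a \<in> {..<2 ^ m}" "b \<in> {..<2 ^ m}" "poly_of_num m a = poly_of_num m b"
    have "(of_nat (a div 2 ^ i) :: bit) = of_nat (b div 2 ^ i)" if "i < m" for i
      using ab(3) that coeff_poly_of_num[of m a i] coeff_poly_of_num[of m b i] by simp
    then have "bit a i = bit b i" if "i < m" for i
      using that by (simp only: parity bit_iff_odd)
    then have "take_bit m a = take_bit m b"
      by (simp add: bit_eq_iff bit_take_bit_iff) blast
    then show "a = b" using ab by (simp add: take_bit_nat_eq_self)
  qed
  show "f \<in> polys_below m" if "f \<in> poly_of_num m ` {..<2 ^ m}" for f
    using that by (auto simp: polys_below_iff coeff_poly_of_num)
  show "f \<in> poly_of_num m ` {..<2 ^ m}" if f: "f \<in> polys_below m" for f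
  proof
    define n :: nat where "n = horner_sum of_bool 2 (map (\<lambda>i. odd (coeff f i)) [0..<m])"
    have bit_n: "bit n i \<longleftrightarrow> i < m \<and> odd (coeff f i)" for i
      by (auto simp: n_def bit_horner_sum_bit_iff)
    show "n \<in> {..<2 ^ m}"
      using horner_sum_of_bool_2_less[of "map (\<lambda>i. odd (coeff f i)) [0..<m]"] by (simp add: n_def)
    show "f = poly_of_num m n"
    proof (rule poly_eqI)
      fix i
      have "coeff f i = of_nat (n div 2 ^ i)" if "i < m"
      proof (cases "coeff f i")
        case zero
        then have "even (n div 2 ^ i)" using bit_n[of i] that by (simp add: bit_iff_odd)
        then show ?thesis using zero by (auto elim!: evenE)
      next
        case one
        then have "odd (n div 2 ^ i)" using bit_n[of i] that by (simp add: bit_iff_odd)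
        then show ?thesis using one by (auto elim!: oddE)
      qed
      then show "coeff f i = coeff (poly_of_num m n) i"
        using f by (auto simp: coeff_poly_of_num polys_below_iff)
    qed
  qed
qed

lemma finite_polys_below: "finite (polys_below m)"
  using bij_betw_finite[OF bij_betw_poly_of_num[of m]] by simp

lemma card_polys_below: "card (polys_below m) = 2 ^ m"
  using bij_betw_same_card[OF bij_betw_poly_of_num[of m]] by simp

lemma finite_dyadic_points: "finite (dyadic_points m s)"
  unfolding dyadic_points_def by (intro finite_PiE) (simp_all add: finite_dyadics)

lemma card_dyadic_points: "card (dyadic_points m s) = (2 ^ m) ^ s"
  by (simp add: dyadic_points_def card_PiE card_dyadics)

section \<open>Lines in the space of dyadic points\<close>

text \<open>
  Under the identification of \<open>V\<close> with \<open>K ^ s\<close>, this adds \<open>n\<close> times the vector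
  \<open>(1, q, ..., q ^ (s - 1))\<close> to \<open>x\<close>.
\<close>
definition shift_along :: "nat \<Rightarrow> nat \<Rightarrow> bit poly \<Rightarrow> bit poly \<Rightarrow> bit poly \<Rightarrow> (nat \<Rightarrow> real) \<Rightarrow> nat \<Rightarrow> real" where
  "shift_along m s p q n x = (\<lambda>j\<in>{..<s}. digit_add m (x j) (frac_value m p (n * q ^ j)))"

lemma digit_add_left_commute_right:
  "digit_add m (digit_add m x y) z = digit_add m (digit_add m x z) y"
  by (metis digit_add_assoc digit_add_commute)

lemma commuting_translations_shift_along:
  "commuting_translations (dyadic_points m s) (polys_below m) I (shift_along m s p)"
proof
  show "finite (dyadic_points m s)" by (rule finite_dyadic_points)
  show "finite (polys_below m)" by (rule finite_polys_below)
  show "polys_below m \<noteq> {}" using zero_in_polys_below by auto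
  show "a + b \<in> polys_below m" if "a \<in> polys_below m" "b \<in> polys_below m" for a b
    using that by (rule polys_below_add)
next
  fix q q' a b x assume x: "x \<in> dyadic_points m s"
  show "shift_along m s p q a x \<in> dyadic_points m s"
    by (auto simp: shift_along_def dyadic_points_def digit_add_in_dyadics)
  show "shift_along m s p q a (shift_along m s p q a x) = x"
    using x by (auto simp: shift_along_def dyadic_points_def fun_eq_iff digit_add_cancel PiE_iff
        extensional_def)
  show "shift_along m s p q a (shift_along m s p q b x) = shift_along m s p q (a + b) x"
    by (auto simp: shift_along_def fun_eq_iff distrib_right frac_value_add digit_add_assoc
        digit_add_commute[of m "frac_value m p (b * _)"])
  show "shift_along m s p q a (shift_along m s p q' b x) = shift_along m s p q' b (shift_along m s p q a x)"
    by (auto simp: shift_along_def fun_eq_iff digit_add_left_commute_right[of m "x _" "frac_value m p (b * _)"])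
qed

text \<open>
  This is the injectivity of a Vandermonde matrix over the field of residues modulo \<open>p\<close>. For a polynomial
  \<open>h\<close> of degree below \<open>s\<close>, the sum of \<open>d q * h q\<close> over \<open>A\<close> is a combination of the given power sums and
  so divisible by \<open>p\<close>; the choice of \<open>h\<close> that vanishes on all of \<open>A\<close> except \<open>u\<close> isolates \<open>d u\<close>.
\<close>
lemma zero_if_power_sums_vanish:
  fixes p :: "bit poly" and d :: "bit poly \<Rightarrow> bit poly"
  assumes p: "irreducible p" "degree p = m"
    and A: "finite A" "card A = s" "A \<subseteq> polys_below m"
    and d: "\<And>q. q \<in> A \<Longrightarrow> d q \<in> polys_below m"
    and sums: "\<And>j. j < s \<Longrightarrow> p dvd (\<Sum>q\<in>A. d q * q ^ j)"
    and u: "u \<in> A"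
  shows "d u = 0"
proof -
  define h :: "bit poly poly" where "h = (\<Prod>v\<in>A - {u}. [:- v, 1:])"
  have h_eval: "poly h q = (\<Prod>v\<in>A - {u}. q - v)" for q
    unfolding h_def poly_prod by (intro prod.cong) auto
  have deg_h: "degree h < s"
  proof -
    have "degree h \<le> (\<Sum>v\<in>A - {u}. degree [:- v, 1:])"
      using degree_prod_sum_le[of "A - {u}" "\<lambda>v. [:- v, 1:]"] A(1) by (simp only: h_def o_def finite_Diff)
    also have "\<dots> = s - 1" using A u by simp
    finally show ?thesis using A u by (metis One_nat_def card_gt_0_iff Suc_pred' empty_iff le_imp_less_Suc)
  qed
  have "(\<Sum>q\<in>A. d q * poly h q) = (\<Sum>q\<in>A. \<Sum>j\<le>degree h. coeff h j * (d q * q ^ j))"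
    by (simp add: poly_altdef sum_distrib_left mult.left_commute)
  also have "\<dots> = (\<Sum>j\<le>degree h. coeff h j * (\<Sum>q\<in>A. d q * q ^ j))"
    by (subst sum.swap) (simp add: sum_distrib_left)
  finally have expand: "(\<Sum>q\<in>A. d q * poly h q) = \<dots>" .
  have "p dvd (\<Sum>q\<in>A. d q * poly h q)"
    unfolding expand
  proof (rule dvd_sum)
    fix j assume "j \<in> {..degree h}"
    then have "j < s" using deg_h by simp
    then show "p dvd coeff h j * (\<Sum>q\<in>A. d q * q ^ j)" by (intro dvd_mult sums)
  qed
  also have "(\<Sum>q\<in>A. d q * poly h q) = d u * poly h u"
  proof -
    have "poly h q = 0" if "q \<in> A - {u}" for q
      unfolding h_eval using that A by (intro prod_zero) auto
    then show ?thesis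
      using sum.remove[OF A(1) u, of "\<lambda>q. d q * poly h q"] by simp
  qed
  finally have dvd: "p dvd d u * poly h u" .
  have small: "\<not> p dvd f" if "f \<in> polys_below m" "f \<noteq> 0" for f
    using that p dvd_imp_degree_le[of p f] by (auto simp: polys_below_def)
  have prime: "prime_elem p" using p(1) by (rule field_poly_irreducible_imp_prime)
  have "\<not> p dvd poly h u"
  proof
    assume "p dvd poly h u"
    then have "p dvd prod_mset (image_mset ((-) u) (mset_set (A - {u})))"
      by (simp only: h_eval prod_unfold_prod_mset)
    then obtain w where "w \<in># image_mset ((-) u) (mset_set (A - {u}))" "p dvd w"
      by (rule prime_elem_dvd_prod_msetE[OF prime])
    then obtain v where v: "v \<in> A - {u}" "p dvd u - v"
      using A(1) by auto
    moreover have "u - v \<in> polys_below m"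
      unfolding bit_poly_minus using v u A by (intro polys_below_add) auto
    ultimately show False using small[of "u - v"] v by auto
  qed
  then have "p dvd d u" using dvd prime prime_elem_dvd_mult_iff by blast
  then show ?thesis using small d[OF u] by blast
qed

lemma digit_add_self: "digit_add m x x = 0"
  by (simp only: digit_add_def bit_add_self) simp

text \<open>
  By the Vandermonde argument the map from coefficient families to points of the span is injective. Both
  sides have \<open>(2 ^ m) ^ s\<close> elements, so \<open>s\<close> different directions span all of \<open>V\<close>, and a function that is
  invariant in each of them takes the same value everywhere.
\<close>
lemma invariant_imp_constant:
  assumes p: "irreducible p" "degree p = m"
    and A: "A \<subseteq> polys_below m" "card A = s"
    and f: "\<And>q n x. q \<in> A \<Longrightarrow> n \<in> polys_below m \<Longrightarrow> x \<in> dyadic_points m s \<Longrightarrow>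
      f (shift_along m s p q n x) = f x"
  shows "\<exists>c. \<forall>x\<in>dyadic_points m s. f x = c"
proof -
  have p0: "p \<noteq> 0" using p(1) by auto
  have fin: "finite A" using A(1) finite_polys_below by (rule finite_subset)
  define span :: "bit poly set \<Rightarrow> (bit poly \<Rightarrow> bit poly) \<Rightarrow> nat \<Rightarrow> real" where
    "span B n = (\<lambda>j\<in>{..<s}. frac_value m p (\<Sum>q\<in>B. n q * q ^ j))" for B n
  have span_in: "span B n \<in> dyadic_points m s" for B n
    by (auto simp: span_def dyadic_points_def frac_value_in_dyadics)
  have const: "f (span B n) = f (span {} n)"
    if "B \<subseteq> A" "\<And>q. q \<in> A \<Longrightarrow> n q \<in> polys_below m" for B n
  proof -
    have "finite B" using that(1) fin by (rule finite_subset)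
    then show ?thesis using that(1)
    proof (induction B)
      case (insert q B)
      have step: "span (insert q B) n = shift_along m s p q (n q) (span B n)"
      proof (rule ext)
        fix j
        have "(\<Sum>r\<in>insert q B. n r * r ^ j) = (\<Sum>r\<in>B. n r * r ^ j) + n q * q ^ j"
          using insert.hyps by (subst add.commute) (rule sum.insert)
        then show "span (insert q B) n j = shift_along m s p q (n q) (span B n) j"
          by (simp add: span_def shift_along_def frac_value_add)
      qed
      have q: "q \<in> A" using insert.prems by simp
      have "f (span (insert q B) n) = f (span B n)"
        unfolding step by (rule f[OF q that(2)[OF q] span_in])
      also have "\<dots> = f (span {} n)"
        by (rule insert.IH) (use insert.prems in simp)
      finally show ?case .
    qed (rule refl)
  qed
  have inj: "inj_on (span A) (A \<rightarrow>\<^sub>E polys_below m)"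
  proof (rule inj_onI)
    fix n n' assume n: "n \<in> A \<rightarrow>\<^sub>E polys_below m" "n' \<in> A \<rightarrow>\<^sub>E polys_below m"
      and eq: "span A n = span A n'"
    have sums: "p dvd (\<Sum>q\<in>A. (n q + n' q) * q ^ j)" if "j < s" for j
    proof (rule frac_value_zero_imp_dvd[OF p0 p(2)])
      have "frac_value m p (\<Sum>q\<in>A. (n q + n' q) * q ^ j)
          = digit_add m (span A n j) (span A n' j)"
        using that by (simp only: span_def frac_value_add sum.distrib distrib_right restrict_apply lessThan_iff if_True)
      then show "frac_value m p (\<Sum>q\<in>A. (n q + n' q) * q ^ j) = 0"
        by (simp add: eq digit_add_self)
    qed
    have "n q + n' q = 0" if "q \<in> A" for q
      by (rule zero_if_power_sums_vanish[OF p fin A(2,1) _ sums that])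
        (use n in \<open>auto intro!: polys_below_add\<close>)
    then have "n q = n' q" if "q \<in> A" for q
      using that add_right_imp_eq[of "n q" "n' q" "n' q"] by (simp only: bit_poly_add_self)
    then show "n = n'" by (rule PiE_ext[OF n])
  qed
  have onto: "span A ` (A \<rightarrow>\<^sub>E polys_below m) = dyadic_points m s"
    using span_in fin A(2)
    by (intro card_subset_eq finite_dyadic_points)
      (auto simp: card_image[OF inj] card_PiE card_polys_below card_dyadic_points)
  show ?thesis
  proof (intro exI ballI)
    fix x assume "x \<in> dyadic_points m s"
    then have "x \<in> span A ` (A \<rightarrow>\<^sub>E polys_below m)" by (simp only: onto)
    then obtain n where x: "x = span A n" and n: "n \<in> A \<rightarrow>\<^sub>E polys_below m" by (rule imageE)
    have "f x = f (span {} n)"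
      unfolding x by (rule const[OF order_refl]) (rule PiE_mem[OF n])
    also have "span {} n = span {} (\<lambda>_. 0)"
      by (simp only: span_def sum.empty)
    finally show "f x = f (span {} (\<lambda>_. 0))" .
  qed
qed

definition line_sum :: "nat \<Rightarrow> nat \<Rightarrow> bit poly \<Rightarrow> ((nat \<Rightarrow> real) \<Rightarrow> real) \<Rightarrow> bit poly \<Rightarrow> (nat \<Rightarrow> real) \<Rightarrow> real" where
  "line_sum m s p g q x = (\<Sum>n\<in>polys_below m. g (shift_along m s p q n x))"

text \<open>
  A function that is invariant in \<open>s\<close> different directions is constant and therefore orthogonal to \<open>g\<close>,
  which has mean 0. So the bound for commuting projections applies with \<open>k = s - 1\<close>.
\<close>
lemma sum_line_sum_square_le:
  assumes s: "s \<ge> 1" and p: "irreducible p" "degree p = m"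
    and g: "(\<Sum>x\<in>dyadic_points m s. g x) = 0"
  shows "(\<Sum>q\<in>polys_below m. \<Sum>x\<in>dyadic_points m s. (line_sum m s p g q x)\<^sup>2)
    \<le> (2 ^ m)\<^sup>2 * (real (s - 1) * (\<Sum>x\<in>dyadic_points m s. (g x)\<^sup>2))"
proof -
  interpret commuting_translations "dyadic_points m s" "polys_below m" "polys_below m" "shift_along m s p"
    by (rule commuting_translations_shift_along)
  have "(\<Sum>q\<in>polys_below m. form (average q g) (average q g)) \<le> real (s - 1) * form g g"
  proof (rule sum_form_average_le[OF finite_polys_below order_refl])
    fix A f assume A: "A \<subseteq> polys_below m" "card A = Suc (s - 1)" "\<And>q. q \<in> A \<Longrightarrow> invariant q f"
    have "card A = s" using A(2) s by simp
    have inv: "f (shift_along m s p q n x) = f x"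
      if "q \<in> A" "n \<in> polys_below m" "x \<in> dyadic_points m s" for q n x
      using A(3)[OF that(1)] that(2,3) by (simp only: invariant_def)
    have "\<exists>c. \<forall>x\<in>dyadic_points m s. f x = c"
      by (rule invariant_imp_constant[OF p A(1) \<open>card A = s\<close> inv])
    then obtain c where "\<forall>x\<in>dyadic_points m s. f x = c" ..
    then have "form f g = (\<Sum>x\<in>dyadic_points m s. c * g x)"
      unfolding form_def by (intro sum.cong) auto
    then show "form f g = 0" by (simp only: sum_distrib_left[symmetric] g mult_zero_right)
  qed
  moreover have "form (average q g) (average q g)
      = (\<Sum>x\<in>dyadic_points m s. (line_sum m s p g q x)\<^sup>2) / (2 ^ m)\<^sup>2" for q
  proof -
    have "form (average q g) (average q g)
        = (\<Sum>x\<in>dyadic_points m s. (line_sum m s p g q x / 2 ^ m)\<^sup>2)"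
      by (simp add: form_def average_def line_sum_def card_polys_below power2_eq_square)
    then show ?thesis by (simp only: power_divide sum_divide_distrib)
  qed
  moreover have "form g g = (\<Sum>x\<in>dyadic_points m s. (g x)\<^sup>2)"
    by (simp only: form_def power2_eq_square)
  ultimately have "(\<Sum>q\<in>polys_below m. \<Sum>x\<in>dyadic_points m s. (line_sum m s p g q x)\<^sup>2) / (2 ^ m)\<^sup>2
      \<le> real (s - 1) * (\<Sum>x\<in>dyadic_points m s. (g x)\<^sup>2)"
    by (simp only: sum_divide_distrib)
  moreover have "(0::real) < (2 ^ m)\<^sup>2" by simp
  ultimately show ?thesis
    by (simp only: pos_divide_le_eq mult.commute[of "(2 ^ m)\<^sup>2"])
qed

lemma sum_line_sum:
  "(\<Sum>x\<in>dyadic_points m s. line_sum m s p g q x) = 2 ^ m * (\<Sum>x\<in>dyadic_points m s. g x)"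
proof -
  interpret commuting_translations "dyadic_points m s" "polys_below m" UNIV "shift_along m s p"
    by (rule commuting_translations_shift_along)
  have "(\<Sum>x\<in>dyadic_points m s. g (shift_along m s p q n x)) = (\<Sum>x\<in>dyadic_points m s. g x)"
    if "n \<in> polys_below m" for n
    by (rule sum.reindex_bij_witness[where i = "shift_along m s p q n" and j = "shift_along m s p q n"])
      (use that t_involution t_closed in auto)
  then show ?thesis
    unfolding line_sum_def by (subst sum.swap) (simp add: card_polys_below)
qed

section \<open>Exponential moment of a line sum\<close>

text \<open>
  For negative \<open>u = - v\<close>, multiply out the quadratic lower bound of \<open>exp v\<close> with \<open>1 - v + v\<^sup>2\<close>: the
  product is at least 1.
\<close>
lemma exp_le_quadratic:
  fixes u :: real
  assumes "\<bar>u\<bar> \<le> 1" shows "exp u \<le> 1 + u + u\<^sup>2"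
proof (cases "u \<ge> 0")
  case True
  then show ?thesis using exp_bound[of u] assms by simp
next
  case False
  define v where "v = - u"
  have v: "0 \<le> v" using False by (simp add: v_def)
  have taylor: "1 + v + v\<^sup>2 / 2 \<le> exp v" by (rule exp_lower_Taylor_quadratic[OF v])
  have "v \<le> 1" using assms by (simp add: v_def)
  then have pos: "0 \<le> 1 - v + v\<^sup>2" by simp
  have "(1 + v + v\<^sup>2 / 2) * (1 - v + v\<^sup>2) = 1 + v\<^sup>2 / 2 + v ^ 3 / 2 + v ^ 4 / 2"
    by (simp add: field_simps power2_eq_square power3_eq_cube power4_eq_xxxx)
  then have "1 \<le> (1 + v + v\<^sup>2 / 2) * (1 - v + v\<^sup>2)" using v by simp
  also have "\<dots> \<le> exp v * (1 - v + v\<^sup>2)" by (rule mult_right_mono[OF taylor pos])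
  finally have "exp (- v) \<le> 1 - v + v\<^sup>2"
    by (simp add: exp_minus inverse_eq_divide divide_le_eq mult.commute)
  then show ?thesis by (simp add: v_def)
qed

text \<open>
  The scale \<open>1 / 2 ^ m\<close> is the largest one that keeps the exponent in the range of the quadratic bound. The
  linear term vanishes, and the quadratic term is the second moment of the line sum.
\<close>
lemma sum_exp_line_sum_le:
  assumes s: "s \<ge> 1" and p: "irreducible p" "degree p = m"
    and g: "(\<Sum>x\<in>dyadic_points m s. g x) = 0" "\<And>x. \<bar>g x\<bar> \<le> 1"
  shows "(\<Sum>(q, x)\<in>polys_below m \<times> dyadic_points m s. exp (line_sum m s p g q x / 2 ^ m))
    \<le> real (card (polys_below m \<times> dyadic_points m s)) * exp (real (s - 1) / 2 ^ m)"
proof -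
  let ?K = "polys_below m" and ?V = "dyadic_points m s" and ?Y = "line_sum m s p g"
  have bound: "\<bar>?Y q x / 2 ^ m\<bar> \<le> 1" for q x
  proof -
    have "\<bar>?Y q x\<bar> \<le> (\<Sum>n\<in>?K. 1)"
      unfolding line_sum_def by (rule order_trans[OF sum_abs sum_mono]) (rule g)
    then show ?thesis by (simp add: card_polys_below)
  qed
  have squares: "(\<Sum>x\<in>?V. (g x)\<^sup>2) \<le> real (card ?V)"
    using sum_mono[of ?V "\<lambda>x. (g x)\<^sup>2" "\<lambda>_. 1"] g(2) by (simp add: abs_square_le_1)
  have card_eq: "real (card (?K \<times> ?V)) = 2 ^ m * real (card ?V)"
    by (simp add: card_cartesian_product card_polys_below)
  have "(\<Sum>(q, x)\<in>?K \<times> ?V. exp (?Y q x / 2 ^ m))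
      \<le> (\<Sum>(q, x)\<in>?K \<times> ?V. 1 + ?Y q x / 2 ^ m + (?Y q x / 2 ^ m)\<^sup>2)"
    by (intro sum_mono) (auto intro!: exp_le_quadratic bound)
  also have "\<dots> = (\<Sum>q\<in>?K. \<Sum>x\<in>?V. 1 + ?Y q x / 2 ^ m + (?Y q x / 2 ^ m)\<^sup>2)"
    by (rule sum.cartesian_product[symmetric])
  also have "\<dots> = real (card (?K \<times> ?V)) + (\<Sum>q\<in>?K. (\<Sum>x\<in>?V. ?Y q x)) / 2 ^ m
      + (\<Sum>q\<in>?K. \<Sum>x\<in>?V. (?Y q x)\<^sup>2) / (2 ^ m)\<^sup>2"
    by (simp add: sum.distrib card_eq card_polys_below power_divide flip: sum_divide_distrib)
  also have "\<dots> = real (card (?K \<times> ?V)) + (\<Sum>q\<in>?K. \<Sum>x\<in>?V. (?Y q x)\<^sup>2) / (2 ^ m)\<^sup>2"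
    by (simp add: sum_line_sum g(1))
  also have "\<dots> \<le> real (card (?K \<times> ?V)) + real (s - 1) * real (card ?V)"
  proof -
    have "(\<Sum>q\<in>?K. \<Sum>x\<in>?V. (?Y q x)\<^sup>2) \<le> (2 ^ m)\<^sup>2 * (real (s - 1) * real (card ?V))"
      by (rule order_trans[OF sum_line_sum_square_le[OF s p g(1)]])
        (intro mult_left_mono squares; simp)
    then show ?thesis by (simp add: pos_divide_le_eq mult_ac)
  qed
  also have "\<dots> = real (card (?K \<times> ?V)) * (1 + real (s - 1) / 2 ^ m)"
    by (simp add: card_eq field_simps)
  also have "\<dots> \<le> real (card (?K \<times> ?V)) * exp (real (s - 1) / 2 ^ m)"
    by (intro mult_left_mono exp_ge_add_one_self) simp
  finally show ?thesis .
qed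

section \<open>Reduction of the star discrepancy to grid boxes\<close>

lemma measure_anchored_box:
  assumes "\<And>j. j < s \<Longrightarrow> 0 \<le> z j"
  shows "measure (\<Pi>\<^sub>M j\<in>{..<s}. lborel) (anchored_box s z) = (\<Prod>j<s. z j)"
proof -
  interpret product_sigma_finite "\<lambda>_::nat. lborel :: real measure"
    by unfold_locales
  have "emeasure (\<Pi>\<^sub>M j\<in>{..<s}. lborel) (anchored_box s z) = (\<Prod>j<s. emeasure lborel {0..<z j})"
    unfolding anchored_box_def by (intro emeasure_PiM) auto
  also have "\<dots> = (\<Prod>j<s. ennreal (z j))"
    by (intro prod.cong refl) (use assms in auto)
  also have "\<dots> = ennreal (\<Prod>j<s. z j)"
    by (rule prod_ennreal) (use assms in auto)
  finally have "emeasure (\<Pi>\<^sub>M j\<in>{..<s}. lborel) (anchored_box s z) = ennreal (\<Prod>j<s. z j)" .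
  moreover have "0 \<le> (\<Prod>j<s. z j)"
    by (rule prod_nonneg) (use assms in simp)
  ultimately show ?thesis by (simp only: measure_def enn2real_ennreal)
qed

definition local_deviation :: "nat \<Rightarrow> (nat \<Rightarrow> real) \<Rightarrow> (nat \<Rightarrow> real) \<Rightarrow> real" where
  "local_deviation s z x = indicator (anchored_box s z) x - (\<Prod>j<s. z j)"

definition grid_corners :: "nat \<Rightarrow> nat \<Rightarrow> (nat \<Rightarrow> real) set" where
  "grid_corners m s = ({..<s} \<rightarrow>\<^sub>E (\<lambda>k. real k / 2 ^ m) ` {..2 ^ m})"

lemma finite_grid_corners: "finite (grid_corners m s)"
  unfolding grid_corners_def by (intro finite_PiE) auto

lemma card_grid_corners: "card (grid_corners m s) = (2 ^ m + 1) ^ s"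
proof -
  have "card ((\<lambda>k. real k / 2 ^ m) ` {..2 ^ m}) = 2 ^ m + 1"
    by (subst card_image) (auto simp: inj_on_def)
  then show ?thesis by (simp only: grid_corners_def card_PiE finite_lessThan card_lessThan prod_constant)
qed

lemma grid_corner_bounds:
  assumes "z \<in> grid_corners m s" "j < s" shows "0 \<le> z j" "z j \<le> 1"
proof -
  have "z j \<in> (\<lambda>k. real k / 2 ^ m) ` {..2 ^ m}"
    using assms by (auto simp: grid_corners_def)
  then show "0 \<le> z j" "z j \<le> 1" by auto
qed

lemma abs_local_deviation_le_1:
  assumes "z \<in> grid_corners m s" shows "\<bar>local_deviation s z x\<bar> \<le> 1"
proof -
  have "0 \<le> (\<Prod>j<s. z j)" "(\<Prod>j<s. z j) \<le> 1"
    using grid_corner_bounds[OF assms] by (auto intro!: prod_nonneg prod_le_1)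
  then show ?thesis by (auto simp: local_deviation_def indicator_def)
qed

text \<open>
  A box with corner on the grid contains \<open>2 ^ m * z j\<close> dyadic numbers in the coordinate \<open>j\<close>, so its share
  of the dyadic points is exactly its volume.
\<close>
lemma sum_local_deviation:
  assumes z: "z \<in> grid_corners m s"
  shows "(\<Sum>x\<in>dyadic_points m s. local_deviation s z x) = 0"
proof -
  have count: "real (card (dyadics m \<inter> {0..<z j})) = 2 ^ m * z j" if "j < s" for j
  proof -
    have "\<exists>k\<le>2 ^ m. z j = real k / 2 ^ m"
    proof -
      have "z j \<in> (\<lambda>k. real k / 2 ^ m) ` {..2 ^ m}"
        using z that by (simp add: grid_corners_def PiE_iff)
      then show ?thesis by auto
    qed
    then obtain k where k: "k \<le> 2 ^ m" "z j = real k / 2 ^ m" by auto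
    have "dyadics m \<inter> {0..<z j} = (\<lambda>i. real i / 2 ^ m) ` {..<k}"
      using k by (auto simp: dyadics_def divide_less_cancel)
    also have "card \<dots> = k"
      by (subst card_image) (auto simp: inj_on_def)
    finally show ?thesis using k(2) by simp
  qed
  have "(\<Sum>x\<in>dyadic_points m s. indicator (anchored_box s z) x)
      = real (card (dyadic_points m s \<inter> anchored_box s z))"
    unfolding indicator_def of_bool_def sum.If_cases[OF finite_dyadic_points] by simp
  also have "dyadic_points m s \<inter> anchored_box s z = (\<Pi>\<^sub>E j\<in>{..<s}. dyadics m \<inter> {0..<z j})"
    by (simp add: dyadic_points_def anchored_box_def PiE_Int)
  also have "real (card \<dots>) = (\<Prod>j<s. real (card (dyadics m \<inter> {0..<z j})))"
    by (simp add: card_PiE)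
  also have "\<dots> = (\<Prod>j<s. 2 ^ m * z j)"
    by (intro prod.cong refl count) simp
  also have "\<dots> = real (card (dyadic_points m s)) * (\<Prod>j<s. z j)"
    by (simp add: prod.distrib card_dyadic_points)
  finally show ?thesis
    by (simp add: local_deviation_def sum_subtractf)
qed

lemma sum_mset_local_deviation:
  "(\<Sum>x\<in>#P. local_deviation s z x)
    = (\<Sum>x\<in>#P. indicator (anchored_box s z) x) - real (size P) * (\<Prod>j<s. z j)"
  by (induction P) (simp_all add: local_deviation_def algebra_simps)

text \<open>
  Rounding each coordinate of a corner up to the next multiple of \<open>1 / 2 ^ m\<close> adds no dyadic point to the
  box and changes its volume by at most \<open>s / 2 ^ m\<close>.
\<close>
lemma star_discrepancy_le_grid:
  assumes P: "set_mset P \<subseteq> dyadic_points m s" "P \<noteq> {#}"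
    and grid: "\<And>z. z \<in> grid_corners m s \<Longrightarrow> \<bar>\<Sum>x\<in>#P. local_deviation s z x\<bar> \<le> real (size P) * \<epsilon>"
  shows "star_discrepancy s P \<le> \<epsilon> + real s / 2 ^ m"
  unfolding star_discrepancy_def
proof (rule cSUP_least)
  show "({..<s} \<rightarrow>\<^sub>E {0..1::real}) \<noteq> {}"
    by (simp add: PiE_eq_empty_iff)
next
  fix z assume z: "z \<in> ({..<s} \<rightarrow>\<^sub>E {0..1::real})"
  have z01: "0 \<le> z j" "z j \<le> 1" if "j < s" for j
    using PiE_mem[OF z, of j] that by simp_all
  define w where "w = (\<lambda>j\<in>{..<s}. real_of_int \<lceil>2 ^ m * z j\<rceil> / 2 ^ m)"
  have w_ge: "z j \<le> w j" and w_le: "w j \<le> z j + 1 / 2 ^ m" if "j < s" for j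
  proof -
    have w_j: "w j = real_of_int \<lceil>2 ^ m * z j\<rceil> / 2 ^ m" using that by (simp add: w_def)
    show "z j \<le> w j"
      unfolding w_j using le_of_int_ceiling[of "2 ^ m * z j"] by (simp add: pos_le_divide_eq mult.commute)
    have "w j \<le> (2 ^ m * z j + 1) / 2 ^ m"
      unfolding w_j by (intro divide_right_mono of_int_ceiling_le_add_one) simp
    then show "w j \<le> z j + 1 / 2 ^ m" by (simp add: add_divide_distrib)
  qed
  have w_grid: "w \<in> grid_corners m s"
    unfolding grid_corners_def
  proof (rule PiE_I)
    fix j assume "j \<in> {..<s}"
    then have j: "j < s" by simp
    have "0 \<le> \<lceil>2 ^ m * z j\<rceil>" using z01(1)[OF j] by (simp add: ceiling_mono order_less_le_trans[of _ 0])
    moreover have "\<lceil>2 ^ m * z j\<rceil> \<le> 2 ^ m"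
      using z01(2)[OF j] by (simp add: ceiling_le_iff)
    ultimately have "nat \<lceil>2 ^ m * z j\<rceil> \<in> {..2 ^ m}" "w j = real (nat \<lceil>2 ^ m * z j\<rceil>) / 2 ^ m"
      using j by (auto simp: w_def nat_le_iff)
    then show "w j \<in> (\<lambda>k. real k / 2 ^ m) ` {..2 ^ m}" by blast
  qed (simp add: w_def)
  note w01 = grid_corner_bounds[OF w_grid]
  have same_box: "indicator (anchored_box s z) x = (indicator (anchored_box s w) x :: real)"
    if x: "x \<in># P" for x
  proof -
    have "x j < z j \<longleftrightarrow> x j < w j" if j: "j < s" for j
    proof -
      have "x j \<in> dyadics m" using x P(1) j by (auto simp: dyadic_points_def)
      then obtain k :: nat where k: "x j = real k / 2 ^ m" by (auto simp: dyadics_def)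
      have "x j < z j \<longleftrightarrow> of_int (int k) < 2 ^ m * z j"
        by (simp add: k pos_divide_less_eq mult.commute)
      also have "\<dots> \<longleftrightarrow> int k < \<lceil>2 ^ m * z j\<rceil>"
        by (simp only: less_ceiling_iff)
      also have "\<dots> \<longleftrightarrow> real_of_int (int k) < real_of_int \<lceil>2 ^ m * z j\<rceil>"
        by (simp only: of_int_less_iff)
      also have "\<dots> \<longleftrightarrow> x j < w j"
        using j by (simp add: k w_def divide_less_cancel)
      finally show ?thesis .
    qed
    moreover have "x \<in> extensional {..<s}" 
      using subsetD[OF P(1) x] by (simp add: dyadic_points_def PiE_iff)
    ultimately have "x \<in> anchored_box s z \<longleftrightarrow> x \<in> anchored_box s w"
      by (auto simp: anchored_box_def PiE_iff)
    then show ?thesis by (simp add: indicator_def)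
  qed
  have N: "real (size P) > 0" using P(2) by (simp add: nonempty_has_size)
  define S where "S = (\<Sum>x\<in>#P. indicator (anchored_box s w) x :: real)"
  have S_eq: "(\<Sum>x\<in>#P. indicator (anchored_box s z) x) = S"
    unfolding S_def by (intro arg_cong[where f = sum_mset] image_mset_cong same_box)
  have "(\<Sum>x\<in>#P. local_deviation s w x) = S - real (size P) * (\<Prod>j<s. w j)"
    unfolding S_def by (rule sum_mset_local_deviation)
  then have "\<bar>S - real (size P) * (\<Prod>j<s. w j)\<bar> \<le> real (size P) * \<epsilon>"
    using grid[OF w_grid] by simp
  moreover have "S - real (size P) * (\<Prod>j<s. w j) = real (size P) * (1 / real (size P) * S - (\<Prod>j<s. w j))"
    using P(2) by (simp add: right_diff_distrib)
  ultimately have "\<bar>1 / real (size P) * S - (\<Prod>j<s. w j)\<bar> \<le> \<epsilon>"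
    using N by (simp only: abs_mult abs_of_pos mult_le_cancel_left_pos)
  moreover have "\<bar>(\<Prod>j<s. w j) - (\<Prod>j<s. z j)\<bar> \<le> real s / 2 ^ m"
  proof -
    have "\<bar>(\<Prod>j<s. w j) - (\<Prod>j<s. z j)\<bar> \<le> (\<Sum>j<s. \<bar>w j - z j\<bar>)"
      using norm_prod_diff[of "{..<s}" w z] w01 z01 by simp
    also have "\<dots> \<le> (\<Sum>j<s. 1 / 2 ^ m)"
    proof (rule sum_mono)
      fix j assume "j \<in> {..<s}"
      then show "\<bar>w j - z j\<bar> \<le> 1 / 2 ^ m" using w_ge[of j] w_le[of j] by (simp add: abs_le_iff)
    qed
    finally show ?thesis by simp
  qed
  ultimately have "\<bar>1 / real (size P) * S - (\<Prod>j<s. z j)\<bar> \<le> \<epsilon> + real s / 2 ^ m" by linarith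
  then show "\<bar>1 / real (size P) * (\<Sum>x\<in>#P. indicator (anchored_box s z) x)
      - measure (\<Pi>\<^sub>M j\<in>{..<s}. lborel) (anchored_box s z)\<bar> \<le> \<epsilon> + real s / 2 ^ m"
    using z01 by (simp add: measure_anchored_box S_eq)
qed

section \<open>Joint law of independent uniform variables\<close>

lemma uniformly_distributed_singleton:
  assumes X: "uniformly_distributed M X A" and A: "finite A" "a \<in> A"
  shows "X -` {a} \<inter> space M \<in> sets M" and "measure M (X -` {a} \<inter> space M) = 1 / real (card A)"
proof -
  have meas: "X \<in> M \<rightarrow>\<^sub>M count_space A"
    and distr: "distr M (count_space A) X = uniform_count_measure A"
    using X by (simp_all add: uniformly_distributed_def)
  show "X -` {a} \<inter> space M \<in> sets M"
    using meas by (rule measurable_sets) (use A in simp)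
  have "measure M (X -` {a} \<inter> space M) = measure (distr M (count_space A) X) {a}"
    using meas A by (subst measure_distr) auto
  also have "\<dots> = 1 / real (card A)"
    unfolding distr using A by (subst measure_uniform_count_measure) auto
  finally show "measure M (X -` {a} \<inter> space M) = 1 / real (card A)" .
qed

lemma uniformly_distributed_mem:
  assumes "uniformly_distributed M X A" "\<omega> \<in> space M" shows "X \<omega> \<in> A"
proof -
  have "X \<in> M \<rightarrow>\<^sub>M count_space A" using assms(1) by (simp add: uniformly_distributed_def)
  from measurable_space[OF this assms(2)] show ?thesis by simp
qed

text \<open>
  Each value \<open>w\<close> of the joint vector is taken on the intersection of the independent events that fix one
  variable each, and all values have the same probability.
\<close>
lemma (in prob_space) prob_joint_uniform:
  fixes R :: "'i set"
  assumes R: "finite R" "R \<noteq> {}" and A: "finite A" and B: "finite B"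
    and X: "\<And>r. r \<in> R \<Longrightarrow> uniformly_distributed M (X r) A"
    and Y: "\<And>r. r \<in> R \<Longrightarrow> uniformly_distributed M (Y r) B"
    and indep: "indep_vars (\<lambda>_. count_space (A <+> B)) (joint_family X Y) (R <+> R)"
    and E: "E \<subseteq> R \<rightarrow>\<^sub>E A \<times> B"
  shows "prob {\<omega> \<in> space M. (\<lambda>r\<in>R. (X r \<omega>, Y r \<omega>)) \<in> E}
    = real (card E) / real (card (R \<rightarrow>\<^sub>E A \<times> B))"
proof -
  define W where "W = (\<lambda>\<omega>. \<lambda>r\<in>R. (X r \<omega>, Y r \<omega>))"
  define F where "F = (\<lambda>w. {\<omega> \<in> space M. W \<omega> = w})"
  define S where "S = (R \<rightarrow>\<^sub>E A \<times> B)"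
  have finS: "finite S" unfolding S_def using R A B by (intro finite_PiE) auto
  have card_S: "real (card S) = (real (card A) * real (card B)) ^ card R"
    using R by (simp add: S_def card_PiE card_cartesian_product)
  have atom: "F w \<in> events \<and> prob (F w) = 1 / real (card S)" if w: "w \<in> S" for w
  proof -
    define c where "c = (\<lambda>k. case k of Inl r \<Rightarrow> Inl (fst (w r)) | Inr r \<Rightarrow> Inr (snd (w r)))"
    define G where "G = (\<lambda>k. joint_family X Y k -` {c k} \<inter> space M)"
    have in_AB: "fst (w r) \<in> A" "snd (w r) \<in> B" if "r \<in> R" for r
      using PiE_mem[OF w[unfolded S_def] that] by auto
    have G_Inl: "G (Inl r) = X r -` {fst (w r)} \<inter> space M" for r
      by (auto simp: G_def joint_family_def c_def)
    have G_Inr: "G (Inr r) = Y r -` {snd (w r)} \<inter> space M" for r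
      by (auto simp: G_def joint_family_def c_def)
    have F_eq: "F w = (\<Inter>k\<in>R <+> R. G k)"
    proof (rule set_eqI)
      fix \<omega>
      have "W \<omega> = w \<longleftrightarrow> (\<forall>r\<in>R. (X r \<omega>, Y r \<omega>) = w r)"
        using w by (auto simp: W_def S_def fun_eq_iff PiE_iff extensional_def)
      then have "\<omega> \<in> F w \<longleftrightarrow> (\<forall>r\<in>R. \<omega> \<in> G (Inl r) \<and> \<omega> \<in> G (Inr r))"
        unfolding F_def G_Inl G_Inr using R(2) by (auto simp: prod_eq_iff)
      also have "\<dots> \<longleftrightarrow> \<omega> \<in> (\<Inter>k\<in>R <+> R. G k)"
        by (auto elim!: PlusE)
      finally show "\<omega> \<in> F w \<longleftrightarrow> \<omega> \<in> (\<Inter>k\<in>R <+> R. G k)" .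
    qed
    have G_event: "G k \<in> events" if "k \<in> R <+> R" for k
      using that by (auto simp: G_Inl G_Inr intro!: uniformly_distributed_singleton(1) X Y A B in_AB)
    have "F w \<in> events"
      unfolding F_eq by (rule sets.finite_INT) (use R G_event in \<open>auto simp: Plus_eq_empty_conv\<close>)
    moreover have "prob (F w) = (\<Prod>k\<in>R <+> R. prob (G k))"
      unfolding F_eq G_def
      by (rule indep_varsD_finite[OF indep]) (use R in_AB in \<open>auto simp: c_def Plus_eq_empty_conv\<close>)
    moreover have "\<dots> = (\<Prod>r\<in>R. prob (G (Inl r))) * (\<Prod>r\<in>R. prob (G (Inr r)))"
      using R by (simp add: prod.Plus)
    moreover have "\<dots> = (\<Prod>r\<in>R. 1 / real (card A)) * (\<Prod>r\<in>R. 1 / real (card B))"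
      unfolding G_Inl G_Inr
      by (intro arg_cong2[where f = "(*)"] prod.cong refl uniformly_distributed_singleton(2) X Y A B in_AB)
    moreover have "\<dots> = 1 / real (card S)"
      by (simp add: card_S power_divide power_mult_distrib)
    ultimately show ?thesis by simp
  qed
  have "{\<omega> \<in> space M. W \<omega> \<in> E} = (\<Union>w\<in>E. F w)"
    by (auto simp: F_def)
  also have "prob \<dots> = (\<Sum>w\<in>E. prob (F w))"
  proof (rule finite_measure_finite_Union)
    show "finite E" using E finS S_def finite_subset by blast
    show "F ` E \<subseteq> events" using atom E by (auto simp: S_def)
    show "disjoint_family_on F E" by (auto simp: disjoint_family_on_def F_def)
  qed
  also have "\<dots> = (\<Sum>w\<in>E. 1 / real (card S))"
    by (rule sum.cong) (use atom E in \<open>auto simp: S_def\<close>)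
  finally show ?thesis by (simp add: W_def S_def)
qed

section \<open>Line sums and shifted Korobov point sets\<close>

lemma sum_mset_of_sum:
  "finite R \<Longrightarrow> (\<Sum>x\<in>#(\<Sum>r\<in>R. F r). g x) = (\<Sum>r\<in>R. \<Sum>x\<in>#F r. g x)"
  by (induction R rule: finite_induct) simp_all

lemma digital_shift_korobov_point:
  assumes "p \<noteq> 0"
  shows "(\<lambda>j\<in>{..<s}. digit_add m (korobov_point m s p q n j) (x j))
    = shift_along m s p q (poly_of_num m n) x"
proof (rule ext)
  fix j
  show "(\<lambda>j\<in>{..<s}. digit_add m (korobov_point m s p q n j) (x j)) j
      = shift_along m s p q (poly_of_num m n) x j"
  proof (cases "j < s")
    case True
    then have "korobov_point m s p q n j = frac_value m p (poly_of_num m n * q ^ j)"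
      using frac_value_mult_mod[OF assms, of m "poly_of_num m n" "q ^ j"]
      by (simp add: korobov_point_def frac_value_def)
    then show ?thesis
      using True by (simp add: shift_along_def digit_add_commute[of m "frac_value m p _"])
  qed (simp add: shift_along_def)
qed

lemma sum_digital_shift:
  assumes "p \<noteq> 0"
  shows "(\<Sum>x\<in>#digital_shift m s y (korobov_point_set m s p q). g x) = line_sum m s p g q y"
proof -
  have "(\<Sum>x\<in>#digital_shift m s y (korobov_point_set m s p q). g x)
      = (\<Sum>n<2 ^ m. g (shift_along m s p q (poly_of_num m n) y))"
    by (simp add: digital_shift_def korobov_point_set_def multiset.map_comp o_def
        digital_shift_korobov_point[OF assms] sum_unfold_sum_mset)
  also have "\<dots> = line_sum m s p g q y"
    unfolding line_sum_def by (rule sum.reindex_bij_betw[OF bij_betw_poly_of_num])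
  finally show ?thesis .
qed

lemma sum_shifted_union:
  assumes "p \<noteq> 0"
  shows "(\<Sum>x\<in>#shifted_union m s p q \<sigma>. g x) = (\<Sum>r\<in>{1..2 ^ m}. line_sum m s p g (q r) (\<sigma> r))"
  unfolding shifted_union_def by (subst sum_mset_of_sum) (simp_all add: sum_digital_shift[OF assms])

lemma size_shifted_union: "size (shifted_union m s p q \<sigma>) = 2 ^ (2 * m)"
  by (simp add: shifted_union_def digital_shift_def korobov_point_set_def mult_2 power_add)

lemma set_shifted_union: "set_mset (shifted_union m s p q \<sigma>) \<subseteq> dyadic_points m s"
  by (auto simp: shifted_union_def set_mset_sum digital_shift_def dyadic_points_def digit_add_in_dyadics
      split: if_splits)

section \<open>Large deviations\<close>

text \<open>
  Chernoff bound by counting: an indicator is dominated by an exponential, and the sum over all choices of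
  a product over the lines is the product of the sums over one line.
\<close>
lemma card_large_sum_le:
  assumes s: "s \<ge> 1" and p: "irreducible p" "degree p = m"
    and g: "(\<Sum>x\<in>dyadic_points m s. g x) = 0" "\<And>x. \<bar>g x\<bar> \<le> 1"
  defines "S \<equiv> {1..2 ^ m::nat} \<rightarrow>\<^sub>E polys_below m \<times> dyadic_points m s"
  shows "real (card {w \<in> S. T < (\<Sum>r\<in>{1..2 ^ m}. line_sum m s p g (fst (w r)) (snd (w r)))})
    \<le> real (card S) * exp (real (s - 1) - T / 2 ^ m)"
proof -
  let ?R = "{1..2 ^ m::nat}" and ?AB = "polys_below m \<times> dyadic_points m s"
  let ?Y = "\<lambda>a. line_sum m s p g (fst a) (snd a)"
  have finAB: "finite ?AB" by (intro finite_cartesian_product finite_polys_below finite_dyadic_points)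
  have finS: "finite S" unfolding S_def using finAB by (intro finite_PiE) auto
  have one: "(\<Sum>a\<in>?AB. exp (?Y a / 2 ^ m)) \<le> real (card ?AB) * exp (real (s - 1) / 2 ^ m)"
    using sum_exp_line_sum_le[OF s p g] by (simp add: case_prod_unfold)
  have "real (card {w \<in> S. T < (\<Sum>r\<in>?R. ?Y (w r))})
      = (\<Sum>w\<in>{w \<in> S. T < (\<Sum>r\<in>?R. ?Y (w r))}. 1)" by simp
  also have "\<dots> \<le> (\<Sum>w\<in>{w \<in> S. T < (\<Sum>r\<in>?R. ?Y (w r))}. exp (((\<Sum>r\<in>?R. ?Y (w r)) - T) / 2 ^ m))"
    by (rule sum_mono) simp
  also have "\<dots> \<le> (\<Sum>w\<in>S. exp (((\<Sum>r\<in>?R. ?Y (w r)) - T) / 2 ^ m))"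
    using finS by (intro sum_mono2) auto
  also have "\<dots> = (\<Sum>w\<in>S. (\<Prod>r\<in>?R. exp (?Y (w r) / 2 ^ m)) * exp (- (T / 2 ^ m)))"
    by (intro sum.cong refl)
      (simp only: diff_conv_add_uminus add_divide_distrib minus_divide_left[symmetric]
        sum_divide_distrib exp_add exp_sum finite_atLeastAtMost)
  also have "\<dots> = (\<Sum>w\<in>S. (\<Prod>r\<in>?R. exp (?Y (w r) / 2 ^ m))) * exp (- (T / 2 ^ m))"
    by (rule sum_distrib_right[symmetric])
  also have "(\<Sum>w\<in>S. (\<Prod>r\<in>?R. exp (?Y (w r) / 2 ^ m))) = (\<Prod>r\<in>?R. \<Sum>a\<in>?AB. exp (?Y a / 2 ^ m))"
    unfolding S_def by (rule prod_sum_PiE[symmetric]) (use finAB in auto)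
  also have "\<dots> = (\<Sum>a\<in>?AB. exp (?Y a / 2 ^ m)) ^ 2 ^ m"
    by (simp only: prod_constant card_atLeastAtMost diff_Suc_1)
  also have "\<dots> \<le> (real (card ?AB) * exp (real (s - 1) / 2 ^ m)) ^ 2 ^ m"
    by (intro power_mono one sum_nonneg) simp
  also have "\<dots> = real (card S) * exp (real (s - 1))"
  proof -
    have "exp (real (s - 1) / 2 ^ m) ^ 2 ^ m = exp (real (s - 1))"
      by (simp flip: exp_of_nat_mult)
    then show ?thesis by (simp add: S_def card_PiE power_mult_distrib)
  qed
  finally show ?thesis by (simp add: exp_diff exp_minus divide_inverse)
qed

lemma line_sum_uminus: "line_sum m s p (\<lambda>x. - g x) q x = - line_sum m s p g q x"
  by (simp add: line_sum_def sum_negf)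

text \<open>
  Union bound over the corners of the grid and the two signs of the deviation.
\<close>
lemma card_large_star_discrepancy_le:
  assumes s: "s \<ge> 1" and p: "irreducible p" "degree p = m"
  defines "S \<equiv> {1..2 ^ m::nat} \<rightarrow>\<^sub>E polys_below m \<times> dyadic_points m s"
  shows "real (card {w \<in> S. star_discrepancy s (shifted_union m s p (\<lambda>r. fst (w r)) (\<lambda>r. snd (w r)))
      > (U + real s) / 2 ^ m})
    \<le> 2 * (2 ^ m + 1) ^ s * exp (real (s - 1) - U) * real (card S)"
proof -
  let ?Y = "\<lambda>g w. \<Sum>r\<in>{1..2 ^ m}. line_sum m s p g (fst (w r)) (snd (w r))"
  let ?P = "\<lambda>w. shifted_union m s p (\<lambda>r. fst (w r)) (\<lambda>r. snd (w r))"
  define T where "T = 2 ^ m * U"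
  define bad where "bad g = {w \<in> S. T < ?Y g w}" for g
  have p0: "p \<noteq> 0" using p(1) by auto
  have finS: "finite S"
    unfolding S_def by (intro finite_PiE finite_cartesian_product finite_polys_below finite_dyadic_points) simp
  have "{w \<in> S. star_discrepancy s (?P w) > (U + real s) / 2 ^ m}
      \<subseteq> (\<Union>z\<in>grid_corners m s. bad (local_deviation s z) \<union> bad (\<lambda>x. - local_deviation s z x))"
  proof (rule subsetI, rule ccontr)
    fix w assume w: "w \<in> {w \<in> S. star_discrepancy s (?P w) > (U + real s) / 2 ^ m}"
      and not_bad: "w \<notin> (\<Union>z\<in>grid_corners m s. bad (local_deviation s z) \<union> bad (\<lambda>x. - local_deviation s z x))"
    have size: "real (size (?P w)) = 2 ^ m * 2 ^ m"
      by (simp add: size_shifted_union mult_2 power_add)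
    have "star_discrepancy s (?P w) \<le> U / 2 ^ m + real s / 2 ^ m"
    proof (rule star_discrepancy_le_grid)
      show "set_mset (?P w) \<subseteq> dyadic_points m s" by (rule set_shifted_union)
      show "?P w \<noteq> {#}" using size by auto
      fix z assume z: "z \<in> grid_corners m s"
      have "?Y (local_deviation s z) w \<le> T" "- ?Y (local_deviation s z) w \<le> T"
        using not_bad z w by (auto simp: bad_def line_sum_uminus sum_negf not_less)
      then have "\<bar>\<Sum>x\<in>#?P w. local_deviation s z x\<bar> \<le> T"
        unfolding sum_shifted_union[OF p0] by (rule abs_leI)
      then show "\<bar>\<Sum>x\<in>#?P w. local_deviation s z x\<bar> \<le> real (size (?P w)) * (U / 2 ^ m)"
        unfolding size T_def by simp
    qed
    then show False using w by (simp add: add_divide_distrib)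
  qed
  then have "card {w \<in> S. star_discrepancy s (?P w) > (U + real s) / 2 ^ m}
      \<le> card (\<Union>z\<in>grid_corners m s. bad (local_deviation s z) \<union> bad (\<lambda>x. - local_deviation s z x))"
    using finS by (intro card_mono finite_UN_I finite_grid_corners) (auto simp: bad_def)
  also have "\<dots> \<le> (\<Sum>z\<in>grid_corners m s. card (bad (local_deviation s z) \<union> bad (\<lambda>x. - local_deviation s z x)))"
    by (rule card_UN_le[OF finite_grid_corners])
  also have "\<dots> \<le> (\<Sum>z\<in>grid_corners m s. card (bad (local_deviation s z)) + card (bad (\<lambda>x. - local_deviation s z x)))"
    by (intro sum_mono card_Un_le)
  finally have "real (card {w \<in> S. star_discrepancy s (?P w) > (U + real s) / 2 ^ m})
      \<le> (\<Sum>z\<in>grid_corners m s. real (card (bad (local_deviation s z))) + real (card (bad (\<lambda>x. - local_deviation s z x))))"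
    by (simp only: of_nat_le_iff flip: of_nat_sum of_nat_add)
  also have "\<dots> \<le> (\<Sum>z\<in>grid_corners m s. 2 * (real (card S) * exp (real (s - 1) - U)))"
  proof (rule sum_mono)
    fix z assume z: "z \<in> grid_corners m s"
    have T: "T / 2 ^ m = U" by (simp add: T_def)
    have "real (card (bad (local_deviation s z))) \<le> real (card S) * exp (real (s - 1) - T / 2 ^ m)"
      unfolding bad_def S_def
      by (rule card_large_sum_le[OF s p sum_local_deviation[OF z] abs_local_deviation_le_1[OF z]])
    moreover have "real (card (bad (\<lambda>x. - local_deviation s z x)))
        \<le> real (card S) * exp (real (s - 1) - T / 2 ^ m)"
      unfolding bad_def S_def
      by (rule card_large_sum_le[OF s p])
        (simp_all add: sum_negf sum_local_deviation[OF z] abs_local_deviation_le_1[OF z])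
    ultimately show "real (card (bad (local_deviation s z))) + real (card (bad (\<lambda>x. - local_deviation s z x)))
        \<le> 2 * (real (card S) * exp (real (s - 1) - U))"
      unfolding T by linarith
  qed
  finally show ?thesis
    by (simp add: card_grid_corners mult_ac add.commute)
qed

section \<open>Numerical estimates and the theorem\<close>

lemma ln_3_bounds: "1.0972 < ln (3::real)" "ln (3::real) < 1.0988"
  using ln_approx_bounds[of 3 4] by (simp_all add: eval_nat_numeral)

lemma C0_bounds: "1.723 \<le> C0" "C0 < 1.724"
proof -
  have ln3: "0 < ln (3::real)" by simp
  have "4.169\<^sup>2 \<le> 1 + 18 / ln (3::real)"
    using ln_3_bounds ln3 by (simp add: field_simps power2_eq_square)
  then have "4.169 \<le> sqrt (1 + 18 / ln 3)" by (rule real_le_rsqrt)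
  then show "1.723 \<le> C0" by (simp add: C0_def)
  have "1 + 18 / ln (3::real) < 4.172\<^sup>2"
    using ln_3_bounds ln3 by (simp add: field_simps power2_eq_square)
  then have "sqrt (1 + 18 / ln 3) < 4.172" by (intro real_less_lsqrt) simp_all
  then show "C0 < 1.724" by (simp add: C0_def)
qed

text \<open>
  In the logarithm, the grid costs \<open>s * ln (2 ^ m + 1) \<le> (m + 1) * s * ln 2\<close> and the second moment
  costs \<open>s - 1\<close>. In \<open>L\<close> the first summand is \<open>(2 * m + 1) * s * ln 2\<close>, which pays for the grid; the
  excess of \<open>C0\<close> over 1, applied to \<open>L \<ge> 2 * s\<close>, pays for the second moment.
\<close>
lemma failure_bound:
  fixes m s :: nat and \<delta> :: real
  assumes s: "s \<ge> 1" and m: "m \<ge> 1" and \<delta>: "0 < \<delta>" "\<delta> < 1"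
  defines "L \<equiv> real s * ln (2 * real (2 ^ (2 * m))) + ln 2 - ln (1 - \<delta>)"
  shows "2 * (2 ^ m + 1) ^ s * exp (real (s - 1) - C0 * L) \<le> 1 - \<delta>"
proof -
  define a where "a = real s * ln 2"
  have ln_2N: "ln (2 * real (2 ^ (2 * m))) = (2 * real m + 1) * ln 2"
  proof -
    have "2 * real (2 ^ (2 * m)) = 2 ^ (2 * m + 1)" by simp
    then show ?thesis by (simp only: ln_realpow zero_less_numeral) simp
  qed
  have L: "L = (2 * real m + 1) * a + ln 2 - ln (1 - \<delta>)"
    unfolding L_def ln_2N a_def by simp
  have a: "a \<ge> real s * (2 / 3)"
    unfolding a_def by (intro mult_left_mono ln2_ge_two_thirds) simp
  have ma: "a \<le> real m * a" using m a by (simp add: mult_le_cancel_right1)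
  have tail: "0 \<le> ln 2 - ln (1 - \<delta>)" using \<delta> by (simp add: order_trans[of _ 0])
  have L_ge: "2 * real s \<le> L"
    using a ma tail unfolding L distrib_right by simp
  have "1.7 * L \<le> C0 * L"
    using C0_bounds L_ge by (intro mult_right_mono) auto
  then have CL: "L + 0.7 * (2 * real s) \<le> C0 * L" using L_ge by simp
  have "(2::real) ^ m + 1 \<le> 2 ^ (m + 1)" by simp
  then have "ln ((2::real) ^ m + 1) \<le> ln (2 ^ (m + 1))"
    by (intro ln_mono) (auto intro: add_pos_pos)
  then have "ln ((2::real) ^ m + 1) \<le> (real m + 1) * ln 2"
    by (simp only: ln_realpow zero_less_numeral of_nat_add of_nat_1)
  then have "real s * ln ((2::real) ^ m + 1) \<le> real s * ((real m + 1) * ln 2)"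
    by (rule mult_left_mono) simp
  then have grid: "real s * ln ((2::real) ^ m + 1) \<le> (real m + 1) * a"
    by (simp only: a_def mult.left_commute)
  have "2 * (2 ^ m + 1) ^ s * exp (real (s - 1) - C0 * L)
      = exp (ln 2 + real s * ln (2 ^ m + 1) + (real (s - 1) - C0 * L))"
    by (simp add: exp_add exp_of_nat_mult add_pos_pos)
  also have "\<dots> \<le> exp (ln (1 - \<delta>))"
  proof -
    have "L = 2 * (real m * a) + a + ln 2 - ln (1 - \<delta>)" by (simp add: L distrib_right)
    moreover have "(real m + 1) * a = real m * a + a" by (simp add: distrib_right)
    moreover have "real (s - 1) = real s - 1" "0 \<le> real s" using s by (simp_all add: of_nat_diff)
    ultimately have "ln 2 + real s * ln (2 ^ m + 1) + (real (s - 1) - C0 * L) \<le> ln (1 - \<delta>)"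
      using grid CL ma a by linarith
    then show ?thesis by simp
  qed
  also have "\<dots> = 1 - \<delta>" using \<delta> by simp
  finally show ?thesis .
qed

theorem theorem1p2:
  fixes s m N :: nat
    and p :: "bit poly"
    and M :: "'w measure"
    and q :: "nat \<Rightarrow> 'w \<Rightarrow> bit poly"
    and \<sigma> :: "nat \<Rightarrow> 'w \<Rightarrow> nat \<Rightarrow> real"
    and P :: "'w \<Rightarrow> (nat \<Rightarrow> real) multiset"
  assumes "s \<ge> 1" and "m \<ge> 1"
    and "irreducible p" and "degree p = m"
    and "prob_space M"
    and "\<And>r. r \<in> {1..2 ^ m} \<Longrightarrow> uniformly_distributed M (q r) (polys_below m)"
    and "\<And>r. r \<in> {1..2 ^ m} \<Longrightarrow> uniformly_distributed M (\<sigma> r) (dyadic_points m s)"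
    and "prob_space.indep_vars M (\<lambda>_. count_space (polys_below m <+> dyadic_points m s))
           (joint_family q \<sigma>) ({1..2 ^ m} <+> {1..2 ^ m})"
    and "\<And>\<omega>. P \<omega> = shifted_union m s p (\<lambda>r. q r \<omega>) (\<lambda>r. \<sigma> r \<omega>)"
    and "N = 2 ^ (2 * m)"
  shows "(\<forall>\<omega>\<in>space M. size (P \<omega>) = N \<and> set_mset (P \<omega>) \<subseteq> dyadic_points m s)
    \<and> (\<forall>\<delta>::real. 0 < \<delta> \<and> \<delta> < 1 \<longrightarrow>
        measure M {\<omega> \<in> space M. star_discrepancy s (P \<omega>)
          \<le> C0 * ((real s * (ln (2 * real N) + 1) + ln 2 - ln (1 - \<delta>)) / real N powr (1 / 2))}
        \<ge> \<delta>)
    \<and> 1.723 \<le> C0 \<and> C0 < 1.724"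
proof (intro conjI ballI allI impI)
  fix \<omega>
  show "size (P \<omega>) = N" by (simp only: assms(9,10) size_shifted_union)
  show "set_mset (P \<omega>) \<subseteq> dyadic_points m s" by (simp only: assms(9) set_shifted_union)
next
  show "1.723 \<le> C0" "C0 < 1.724" by (rule C0_bounds)+
next
  fix \<delta> :: real assume "0 < \<delta> \<and> \<delta> < 1"
  then have \<delta>: "0 < \<delta>" "\<delta> < 1" by simp_all
  interpret prob_space M by (rule assms(5))
  define S where "S = ({1..2 ^ m::nat} \<rightarrow>\<^sub>E polys_below m \<times> dyadic_points m s)"
  define bound where
    "bound = C0 * ((real s * (ln (2 * real N) + 1) + ln 2 - ln (1 - \<delta>)) / real N powr (1 / 2))"
  define L where "L = real s * ln (2 * real (2 ^ (2 * m))) + ln 2 - ln (1 - \<delta>)"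
  define disc where "disc = (\<lambda>w. star_discrepancy s (shifted_union m s p (\<lambda>r. fst (w r)) (\<lambda>r. snd (w r))))"
  define E where "E = {w \<in> S. disc w \<le> bound}"
  have finS: "finite S"
    unfolding S_def by (intro finite_PiE finite_cartesian_product finite_polys_below finite_dyadic_points) simp
  have "card S > 0"
    unfolding S_def by (simp add: card_PiE card_cartesian_product card_polys_below card_dyadic_points)
  have sqrt_N: "real N powr (1 / 2) = 2 ^ m"
    by (simp add: assms(10) powr_half_sqrt power_mult mult.commute[of 2] real_sqrt_power)
  \<comment> \<open>The rounding error s / 2 ^ m is covered by the summand 1 next to ln (2 * N), as C0 is at least 1.\<close>
  have "C0 * L + real s \<le> C0 * (L + real s)"
    using mult_right_mono[OF C0_bounds(1), of "real s"] by (simp add: distrib_left)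
  then have bound_ge: "(C0 * L + real s) / 2 ^ m \<le> bound"
    unfolding bound_def sqrt_N unfolding L_def assms(10) by (simp add: divide_right_mono algebra_simps)
  have "real (card {w \<in> S. disc w > bound}) \<le> real (card {w \<in> S. disc w > (C0 * L + real s) / 2 ^ m})"
    using finS bound_ge by (intro of_nat_mono card_mono) auto
  also have "\<dots> \<le> 2 * (2 ^ m + 1) ^ s * exp (real (s - 1) - C0 * L) * real (card S)"
    unfolding disc_def S_def by (rule card_large_star_discrepancy_le[OF assms(1,3,4)])
  also have "\<dots> \<le> (1 - \<delta>) * real (card S)"
    unfolding L_def by (intro mult_right_mono failure_bound assms(1,2) \<delta>) simp
  finally have few_bad: "real (card {w \<in> S. disc w > bound}) \<le> (1 - \<delta>) * real (card S)" .
  have "card S = card E + card {w \<in> S. disc w > bound}"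
    unfolding E_def using finS by (subst card_Un_disjoint[symmetric]) (auto intro!: arg_cong[where f = card])
  then have many_good: "\<delta> * real (card S) \<le> real (card E)"
    using few_bad by (simp add: left_diff_distrib)
  have "\<delta> \<le> real (card E) / real (card S)"
    using many_good \<open>card S > 0\<close> by (simp add: pos_le_divide_eq)
  also have "\<dots> = prob {\<omega> \<in> space M. (\<lambda>r\<in>{1..2 ^ m}. (q r \<omega>, \<sigma> r \<omega>)) \<in> E}"
    unfolding S_def
    by (rule prob_joint_uniform[symmetric])
      (use assms(6,7,8) finite_polys_below finite_dyadic_points in \<open>auto simp: E_def S_def\<close>)
  \<comment> \<open>The multiset depends on the sample point only through the finitely valued joint vector, so the
    event of the theorem is measurable and has the computed probability.\<close>
  also have "{\<omega> \<in> space M. (\<lambda>r\<in>{1..2 ^ m}. (q r \<omega>, \<sigma> r \<omega>)) \<in> E}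
      = {\<omega> \<in> space M. star_discrepancy s (P \<omega>) \<le> bound}"
  proof (intro Collect_cong conj_cong refl)
    fix \<omega> assume \<omega>: "\<omega> \<in> space M"
    have "(\<lambda>r\<in>{1..2 ^ m}. (q r \<omega>, \<sigma> r \<omega>)) \<in> S"
      unfolding S_def
      using uniformly_distributed_mem[OF assms(6) \<omega>] uniformly_distributed_mem[OF assms(7) \<omega>]
      by (simp add: PiE_iff)
    moreover have "disc (\<lambda>r\<in>{1..2 ^ m}. (q r \<omega>, \<sigma> r \<omega>)) = star_discrepancy s (P \<omega>)"
      unfolding disc_def assms(9) shifted_union_def
      by (intro arg_cong[where f = "star_discrepancy s"] sum.cong refl) simp
    ultimately show "(\<lambda>r\<in>{1..2 ^ m}. (q r \<omega>, \<sigma> r \<omega>)) \<in> E \<longleftrightarrow> star_discrepancy s (P \<omega>) \<le> bound"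
      by (simp add: E_def)
  qed
  finally show "\<delta> \<le> prob {\<omega> \<in> space M. star_discrepancy s (P \<omega>)
      \<le> C0 * ((real s * (ln (2 * real N) + 1) + ln 2 - ln (1 - \<delta>)) / real N powr (1 / 2))}"
    by (simp only: bound_def)
qed

end
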